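(* Let $\Omega \subset \mathbb{R}^n$ be a compact region such that $I_\Omega^{\mathrm{TV}}(t) < +\infty$ for all $t \in [0,\mathrm{vol}(\Omega))$. Then the function $I_\Omega^{\mathrm{TV}}$ is the lower convex envelope of $I_\Omega$ on $[0,\mathrm{vol}(\Omega)]$, i.e., the largest convex function $g$ on $[0,\mathrm{vol}(\Omega)]$ satisfying $g(t) \le I_\Omega(t)$ for all $t \in [0,\mathrm{vol}(\Omega)]$.
   Context: $\mathrm{vol}$ denotes Lebesgue measure on $\mathbb{R}^n$ and $\mathbb{1}_\Sigma$ the indicator function of $\Sigma$. For $f \in L^1(\mathbb{R}^n)$, the total variation is $$\mathrm{TV}[f] := \sup\left\{ \int_{\mathbb{R}^n} f(x)\, \nabla\cdot\phi(x)\, dx : \phi \in C_c^1(\mathbb{R}^n \to \mathbb{R}^n),\ \|\phi\|_\infty \le 1\right\} \in [0,+\infty],$$ where $\|\phi\|_\infty$ is the supremum over $x$ of the Euclidean norm of $\phi(x)$. For a measurable set $\Sigma$ of finite volume, the area of its boundary is understood as the perimeter $\mathrm{area}(\partial\Sigma) = \mathrm{TV}[\mathbb{1}_\Sigma]$ (the full perimeter in $\mathbb{R}^n$, including any part shared with $\partial\Omega$). For $t \in [0,\mathrm{vol}(\Omega)]$, the isoperimetric profile of $\Omega$ is $$I_\Omega(t) := \inf\{\mathrm{area}(\partial\Sigma) : \Sigma \subseteq \Omega \text{ measurable},\ \mathrm{vol}(\Sigma) = t\} \in [0,+\infty],$$ equivalently the infimum of $\mathrm{TV}[f]$ over $f \in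 L^1(\mathbb{R}^n)$ with $\int f = t$, $0\le f\le \mathbb{1}_\Omega$ and $f(x)\in\{0,1\}$ for all $x$. The total variation (TV) profile of $\Omega$ is $$I_\Omega^{\mathrm{TV}}(t) := \min\left\{ \mathrm{TV}[f] : f \in L^1(\mathbb{R}^n),\ \int_{\mathbb{R}^n} f(x)\,dx = t,\ 0 \le f \le \mathbb{1}_\Omega \text{ a.e.}\right\},$$ with value $+\infty$ if every admissible $f$ has infinite total variation. Convex functions may take the value $+\infty$. *)

theory Defs
  imports "HOL-Analysis.Analysis"
begin

definition C1_compact_support :: "(real^'n \<Rightarrow> real^'n) \<Rightarrow> bool" where
  "C1_compact_support \<phi> \<longleftrightarrow>
     (\<exists>\<phi>' :: real^'n \<Rightarrow> (real^'n) \<Rightarrow>\<^sub>L (real^'n).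
        (\<forall>x. (\<phi> has_derivative blinfun_apply (\<phi>' x)) (at x)) \<and> continuous_on UNIV \<phi>') \<and>
     compact (closure {x. \<phi> x \<noteq> 0})"

definition divergence :: "(real^'n \<Rightarrow> real^'n) \<Rightarrow> real^'n \<Rightarrow> real" where
  "divergence \<phi> x = (\<Sum>i\<in>UNIV. frechet_derivative \<phi> (at x) (axis i 1) $ i)"

text \<open>Intended for integrable functions only. The value is never negative, since the zero
  field is admissible.\<close>

definition total_variation :: "(real^'n \<Rightarrow> real) \<Rightarrow> ereal" where
  "total_variation f =
     (SUP \<phi> \<in> {\<phi>. C1_compact_support \<phi> \<and> (\<forall>x. norm (\<phi> x) \<le> 1)}.
        ereal (LINT x|lebesgue. f x * divergence \<phi> x))"

definition perimeter :: "(real^'n) set \<Rightarrow> ereal" where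
  "perimeter \<Sigma> = total_variation (indicat_real \<Sigma>)"

definition isoperimetric_profile :: "(real^'n) set \<Rightarrow> real \<Rightarrow> ereal" where
  "isoperimetric_profile \<Omega> t =
     (INF \<Sigma> \<in> {\<Sigma>. \<Sigma> \<subseteq> \<Omega> \<and> \<Sigma> \<in> lmeasurable \<and> measure lebesgue \<Sigma> = t}. perimeter \<Sigma>)"

text \<open>The minimum is rendered as an infimum in the extended reals, which is \<open>\<infinity>\<close> if every
  admissible function has infinite total variation and is the minimum whenever one exists.\<close>

definition TV_profile :: "(real^'n) set \<Rightarrow> real \<Rightarrow> ereal" where
  "TV_profile \<Omega> t =
     (INF f \<in> {f. integrable lebesgue f \<and> (LINT x|lebesgue. f x) = t \<and>
                  (AE x in lebesgue. 0 \<le> f x \<and> f x \<le> indicat_real \<Omega> x)}.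
        total_variation f)"

text \<open>Convexity for functions with values in \<open>(-\<infinity>, \<infinity>]\<close>; the convention \<open>0 * \<infinity> = 0\<close> of the
  extended reals makes the inequality trivial for the weights 0 and 1.\<close>

definition ereal_convex_on :: "real set \<Rightarrow> (real \<Rightarrow> ereal) \<Rightarrow> bool" where
  "ereal_convex_on S g \<longleftrightarrow>
     convex S \<and> (\<forall>x\<in>S. g x \<noteq> -\<infinity>) \<and>
     (\<forall>x\<in>S. \<forall>y\<in>S. \<forall>u\<ge>0. \<forall>v\<ge>0. u + v = 1 \<longrightarrow>
        g (u * x + v * y) \<le> ereal u * g x + ereal v * g y)"

definition is_lower_convex_envelope_on :: "real set \<Rightarrow> (real \<Rightarrow> ereal) \<Rightarrow> (real \<Rightarrow> ereal) \<Rightarrow> bool" where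
  "is_lower_convex_envelope_on S h f \<longleftrightarrow>
     ereal_convex_on S h \<and> (\<forall>t\<in>S. h t \<le> f t) \<and>
     (\<forall>g. ereal_convex_on S g \<and> (\<forall>t\<in>S. g t \<le> f t) \<longrightarrow> (\<forall>t\<in>S. g t \<le> h t))"

end

theory Submission
  imports Defs
begin

text \<open>Total variation is convex and indicator functions compete for the TV profile, so the TV profile
  is a convex minorant of the isoperimetric profile. The substance is that it dominates every
  other convex minorant \<open>g\<close>. The coarea formula and Jensen's inequality would give this:
  \<open>TV[f] = \<integral> area(\<partial>{f > s}) ds \<ge> \<integral> g(vol {f > s}) ds \<ge> g(\<integral> f)\<close>, the integrals in \<open>s\<close> being over
  \<open>[0, 1]\<close>.

  The proof keeps only one consequence of these two facts. At an interior \<open>t\<close>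
  the convex function \<open>g\<close> has a supporting line \<open>a s + b\<close>, and then every Borel set \<open>E \<subseteq> \<Omega>\<close> has
  perimeter at least \<open>a vol(E) + b\<close>. It suffices to extend this affine bound from sets to functions
  \<open>0 \<le> f \<le> 1\<^sub>\<Omega>\<close>, which is \<open>total_variation_ge_affine\<close>; for \<open>\<integral> f = t\<close> it reads \<open>g(t) \<le> TV[f]\<close>.
  The function \<open>f\<close> is built up from below. When the truncation height moves from \<open>s\<close> to \<open>t\<close>, a
  thin slab is added whose rescaling converges to the indicator of \<open>{f > s}\<close>; by lower semicontinuity
  of the total variation, the slab contributes at least the perimeter of \<open>{f > s}\<close> to first order. The
  contributions add up because of \<open>total_variation_truncation\<close>, which states that
  \<open>TV[min f c] + TV[max (f - c) 0] \<le> TV[f]\<close>, and a real-variable argument, applied at every height \<open>s\<close>,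
  sums the increments without any measurability in \<open>s\<close>.

  The truncation inequality is proved first for C1 functions \<open>u\<close>, by gluing test fields \<open>\<phi>\<close> and \<open>\<psi>\<close> for
  the two truncations into the single field \<open>\<chi>(u) \<phi> + (1 - \<chi>(u)) \<psi>\<close> with a smooth cutoff \<open>\<chi>\<close> that
  drops from \<open>1\<close> to \<open>0\<close> near \<open>c\<close>. Mollification, which does not increase the total variation and
  converges in L1, transfers it to measurable functions.

  At the two ends of \<open>[0, vol(\<Omega>)]\<close> there is only one competitor up to null sets, the indicator of
  the empty set or of \<open>\<Omega>\<close>, and the bound is immediate. The finiteness hypothesis ensures that \<open>g\<close> is finite somewhere to the right of \<open>t\<close>, as
  the existence of a supporting line requires.\<close>

section \<open>C1 vector fields with compact support and their divergence\<close>

lemma uniformly_continuous_on_if_vanishing_outside_cball: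
  fixes f :: "'a::euclidean_space \<Rightarrow> 'b::real_normed_vector"
  assumes cont: "continuous_on UNIV f" and zero: "\<And>x. r < norm x \<Longrightarrow> f x = 0"
  shows "uniformly_continuous_on UNIV f"
  unfolding uniformly_continuous_on_def
proof (intro allI impI)
  fix e :: real assume "e > 0"
  have "uniformly_continuous_on (cball 0 (r + 2)) f"
    by (intro compact_uniformly_continuous continuous_on_subset[OF cont]) auto
  then obtain d where d: "d > 0"
    "\<And>x y. x \<in> cball 0 (r + 2) \<Longrightarrow> y \<in> cball 0 (r + 2) \<Longrightarrow> dist y x < d \<Longrightarrow> dist (f y) (f x) < e"
    using \<open>e > 0\<close> unfolding uniformly_continuous_on_def by metis
  have "dist (f y) (f x) < e" if "dist y x < min d 1" for x y
  proof (cases "norm x \<le> r + 1")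
    case True
    have "norm y \<le> norm x + dist y x"
      by (metis dist_commute dist_norm norm_triangle_sub norm_minus_commute)
    then show ?thesis using True that d(2)[of x y] by auto
  next
    case False
    have "norm x \<le> norm y + dist y x"
      by (metis dist_commute dist_norm norm_triangle_sub norm_minus_commute)
    then show ?thesis using False that zero[of x] zero[of y] \<open>e > 0\<close> by auto
  qed
  then show "\<exists>d>0. \<forall>x\<in>UNIV. \<forall>x'\<in>UNIV. dist x' x < d \<longrightarrow> dist (f x') (f x) < e"
    using d(1) by (intro exI[of _ "min d 1"]) auto
qed

lemma continuous_on_UNIV_if_has_derivative:
  "(\<And>x. (f has_derivative f' x) (at x)) \<Longrightarrow> continuous_on UNIV f"
  by (intro continuous_at_imp_continuous_on ballI) (rule has_derivative_continuous)

lemma integrable_if_continuous_vanishing_outside_cball: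
  fixes f :: "'a::euclidean_space \<Rightarrow> 'b::{banach, second_countable_topology}"
  assumes cont: "continuous_on UNIV f" and zero: "\<And>x. r < norm x \<Longrightarrow> f x = 0"
  shows "integrable lborel f"
proof -
  have "integrable lborel (\<lambda>x. indicator (cball 0 r) x *\<^sub>R f x)"
    by (intro borel_integrable_compact continuous_on_subset[OF cont]) auto
  moreover have "(\<lambda>x. indicator (cball 0 r) x *\<^sub>R f x) = f"
    using zero by (auto simp: fun_eq_iff indicator_def not_le)
  ultimately show ?thesis by simp
qed

text \<open>One radius \<open>d\<close> serves every base point, which is what allows the linear approximation to be
integrated over \<open>x\<close>, both in the divergence theorem and in differentiating a convolution.\<close>

lemma uniform_linear_approximation:
  fixes f :: "'a::euclidean_space \<Rightarrow> 'b::real_normed_vector"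
  assumes deriv: "\<And>x. (f has_derivative blinfun_apply (f' x)) (at x)"
    and unif: "uniformly_continuous_on UNIV f'" and "e > 0"
  obtains d where "d > 0"
    "\<And>x h. norm h < d \<Longrightarrow> norm (f (x + h) - f x - blinfun_apply (f' x) h) \<le> e * norm h"
proof -
  obtain d where d: "d > 0" "\<And>x y. dist y x < d \<Longrightarrow> dist (f' y) (f' x) < e"
    using unif \<open>e > 0\<close> unfolding uniformly_continuous_on_def by (metis UNIV_I)
  have lin: "norm (f (x + h) - f x - blinfun_apply (f' x) h) \<le> e * norm h" if h: "norm h < d" for x h
  proof -
    have "norm (f (x + h) - f x - blinfun_apply (f' x) (x + h - x)) \<le> norm (x + h - x) * e"
    proof (rule differentiable_bound_linearization[where S = "ball x d"])
      fix t :: real assume "t \<in> {0..1}"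
      then have "t * norm h \<le> 1 * norm h"
        by (intro mult_right_mono) auto
      then show "x + t *\<^sub>R (x + h - x) \<in> ball x d"
        using \<open>t \<in> {0..1}\<close> h by (simp add: dist_norm)
    next
      fix y assume "y \<in> ball x d"
      then have "norm (f' y - f' x) \<le> e"
        using d(2)[of y x] by (simp add: dist_commute dist_norm norm_minus_commute less_imp_le)
      then show "onorm (blinfun_apply (f' y) - blinfun_apply (f' x)) \<le> e"
        by (simp add: norm_blinfun.rep_eq minus_blinfun.rep_eq fun_diff_def)
    qed (use d(1) in \<open>auto intro: has_derivative_at_withinI[OF deriv]\<close>)
    then show ?thesis by (simp add: mult.commute)
  qed
  show thesis by (rule that[OF d(1) lin])
qed

text \<open>A derivative vanishes on the open set where the field does, so field and derivative share a radius
of support.\<close>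

lemma C1_compact_supportE:
  assumes "C1_compact_support \<phi>"
  obtains \<phi>' r where "\<And>x. (\<phi> has_derivative blinfun_apply (\<phi>' x)) (at x)"
    "continuous_on UNIV \<phi>'" "r > 0"
    "\<And>x. r < norm x \<Longrightarrow> \<phi> x = 0" "\<And>x. r < norm x \<Longrightarrow> \<phi>' x = 0"
proof -
  obtain \<phi>' where \<phi>': "\<And>x. (\<phi> has_derivative blinfun_apply (\<phi>' x)) (at x)"
    "continuous_on UNIV \<phi>'" and "compact (closure {x. \<phi> x \<noteq> 0})"
    using assms unfolding C1_compact_support_def by blast
  then have supp: "compact (closure {x. \<phi> x \<noteq> 0})" by blast
  have "bounded {x. \<phi> x \<noteq> 0}"
    by (rule bounded_subset[OF compact_imp_bounded[OF supp] closure_subset])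
  then obtain r where r: "r > 0" "\<And>x. \<phi> x \<noteq> 0 \<Longrightarrow> norm x \<le> r"
    unfolding bounded_pos by auto
  have zero: "\<phi> x = 0" if "r < norm x" for x
    using r(2) that by fastforce
  have zero': "\<phi>' x = 0" if x: "r < norm x" for x
  proof -
    have "open {x::real^'n. r < norm x}"
      by (intro open_Collect_less continuous_intros)
    then have "(\<phi> has_derivative (\<lambda>_. 0)) (at x)"
      using has_derivative_transform_within_open[of "\<lambda>_. 0" "\<lambda>_. 0" x UNIV "{x. r < norm x}" \<phi>] x zero
      by auto
    then have "blinfun_apply (\<phi>' x) = (\<lambda>_. 0)"
      using has_derivative_unique[OF \<phi>'(1)] by blast
    then show ?thesis by (intro blinfun_eqI) simp
  qed
  show thesis by (rule that[OF \<phi>'(1,2) r(1) zero zero'])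
qed

lemma C1_compact_supportI:
  assumes "\<And>x. (\<phi> has_derivative blinfun_apply (\<phi>' x)) (at x)" "continuous_on UNIV \<phi>'"
    and zero: "\<And>x. r < norm x \<Longrightarrow> \<phi> x = 0"
  shows "C1_compact_support \<phi>"
proof -
  have "{x. \<phi> x \<noteq> 0} \<subseteq> cball 0 r"
    using zero by (force simp: not_le)
  then have "bounded (closure {x. \<phi> x \<noteq> 0})"
    using bounded_subset bounded_cball bounded_closure by metis
  then have "compact (closure {x. \<phi> x \<noteq> 0})"
    by (simp add: compact_eq_bounded_closed)
  with assms(1,2) show ?thesis unfolding C1_compact_support_def by blast
qed

lemma divergence_eq:
  assumes "(\<phi> has_derivative blinfun_apply L) (at x)"
  shows "divergence \<phi> x = (\<Sum>i\<in>UNIV. blinfun_apply L (axis i 1) $ i)"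
  using frechet_derivative_at[OF assms] by (simp add: divergence_def)

lemma divergenceE:
  assumes "C1_compact_support \<phi>"
  obtains r B where "r > 0" "B > 0" "continuous_on UNIV (divergence \<phi>)"
    "\<And>x. r < norm x \<Longrightarrow> divergence \<phi> x = 0" "\<And>x. \<bar>divergence \<phi> x\<bar> \<le> B"
proof -
  obtain \<phi>' r where \<phi>': "\<And>x. (\<phi> has_derivative blinfun_apply (\<phi>' x)) (at x)"
    "continuous_on UNIV \<phi>'" "r > 0" "\<And>x. r < norm x \<Longrightarrow> \<phi>' x = 0"
    using C1_compact_supportE[OF assms] by metis
  have "divergence \<phi> = (\<lambda>x. \<Sum>i\<in>UNIV. blinfun_apply (\<phi>' x) (axis i 1) $ i)"
    using divergence_eq[OF \<phi>'(1)] by blast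
  then have cont: "continuous_on UNIV (divergence \<phi>)"
    using \<phi>'(2) by (auto intro!: continuous_intros)
  have zero: "divergence \<phi> x = 0" if "r < norm x" for x
    using divergence_eq[OF \<phi>'(1)] \<phi>'(4)[OF that] by simp
  have "bounded (divergence \<phi> ` cball 0 r)"
    by (intro compact_imp_bounded compact_continuous_image continuous_on_subset[OF cont]) auto
  then obtain B where B: "B > 0" "\<And>x. norm x \<le> r \<Longrightarrow> \<bar>divergence \<phi> x\<bar> \<le> B"
    unfolding bounded_pos by auto
  have bound: "\<bar>divergence \<phi> x\<bar> \<le> B" for x
    using B zero[of x] by (cases "norm x \<le> r") auto
  show thesis by (rule that[OF \<phi>'(3) B(1) cont zero bound])
qed

lemma borel_measurable_divergence:
  "C1_compact_support \<phi> \<Longrightarrow> divergence \<phi> \<in> borel_measurable borel"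
  by (metis divergenceE borel_measurable_continuous_onI)

lemma C1_compact_support_add:
  assumes "C1_compact_support \<phi>" "C1_compact_support \<psi>"
  shows "C1_compact_support (\<lambda>x. \<phi> x + \<psi> x)"
    "divergence (\<lambda>x. \<phi> x + \<psi> x) x = divergence \<phi> x + divergence \<psi> x"
proof -
  obtain \<phi>' r where \<phi>': "\<And>x. (\<phi> has_derivative blinfun_apply (\<phi>' x)) (at x)"
    "continuous_on UNIV \<phi>'" "\<And>x. r < norm x \<Longrightarrow> \<phi> x = 0"
    using C1_compact_supportE[OF assms(1)] by metis
  obtain \<psi>' s where \<psi>': "\<And>x. (\<psi> has_derivative blinfun_apply (\<psi>' x)) (at x)"
    "continuous_on UNIV \<psi>'" "\<And>x. s < norm x \<Longrightarrow> \<psi> x = 0"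
    using C1_compact_supportE[OF assms(2)] by metis
  have d: "((\<lambda>x. \<phi> x + \<psi> x) has_derivative blinfun_apply (\<phi>' x + \<psi>' x)) (at x)" for x
    using has_derivative_add[OF \<phi>'(1) \<psi>'(1)] by (simp add: plus_blinfun.rep_eq)
  show "C1_compact_support (\<lambda>x. \<phi> x + \<psi> x)"
    by (rule C1_compact_supportI[OF d, where r = "max r s"])
       (use \<phi>' \<psi>' in \<open>auto intro!: continuous_intros\<close>)
  show "divergence (\<lambda>x. \<phi> x + \<psi> x) x = divergence \<phi> x + divergence \<psi> x"
    by (simp add: divergence_eq[OF d] divergence_eq[OF \<phi>'(1)] divergence_eq[OF \<psi>'(1)]
        plus_blinfun.rep_eq sum.distrib)
qed

lemma C1_compact_support_scaleR:
  fixes w :: "real^'n \<Rightarrow> real" and W :: "real^'n \<Rightarrow> real^'n"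
  assumes "C1_compact_support \<phi>"
    and w: "\<And>x. (w has_derivative (\<lambda>h. W x \<bullet> h)) (at x)" and W: "continuous_on UNIV W"
  shows "C1_compact_support (\<lambda>x. w x *\<^sub>R \<phi> x)"
    "divergence (\<lambda>x. w x *\<^sub>R \<phi> x) x = W x \<bullet> \<phi> x + w x * divergence \<phi> x"
proof -
  obtain \<phi>' r where \<phi>': "\<And>x. (\<phi> has_derivative blinfun_apply (\<phi>' x)) (at x)"
    "continuous_on UNIV \<phi>'" "\<And>x. r < norm x \<Longrightarrow> \<phi> x = 0"
    using C1_compact_supportE[OF assms(1)] by metis
  have contw: "continuous_on UNIV w"
    by (rule continuous_on_UNIV_if_has_derivative[OF w])
  have cont\<phi>: "continuous_on UNIV \<phi>"
    by (rule continuous_on_UNIV_if_has_derivative[OF \<phi>'(1)])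
  define D where "D x = w x *\<^sub>R \<phi>' x
      + (blinfun_scaleR_left (\<phi> x) o\<^sub>L blinfun_inner_right (W x))" for x
  have D: "blinfun_apply (D x) h = w x *\<^sub>R blinfun_apply (\<phi>' x) h + (W x \<bullet> h) *\<^sub>R \<phi> x" for x h
    by (simp add: D_def plus_blinfun.rep_eq scaleR_blinfun.rep_eq)
  have d: "((\<lambda>x. w x *\<^sub>R \<phi> x) has_derivative blinfun_apply (D x)) (at x)" for x
    using has_derivative_scaleR[OF w \<phi>'(1)] by (simp add: D[abs_def])
  have "continuous_on UNIV D"
    unfolding D_def
    by (intro continuous_on_add continuous_on_scaleR contw \<phi>'(2)
        bounded_bilinear.continuous_on[OF bounded_bilinear_blinfun_compose]
        bounded_linear.continuous_on[OF bounded_linear_blinfun_scaleR_left cont\<phi>]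
        bounded_linear.continuous_on[OF bounded_linear_blinfun_inner_right W])
  with d \<phi>'(3) show "C1_compact_support (\<lambda>x. w x *\<^sub>R \<phi> x)"
    by (intro C1_compact_supportI[OF d, where r = r]) auto
  have "(\<Sum>i\<in>UNIV. W x $ i * \<phi> x $ i) = W x \<bullet> \<phi> x"
    by (simp add: inner_vec_def)
  then show "divergence (\<lambda>x. w x *\<^sub>R \<phi> x) x = W x \<bullet> \<phi> x + w x * divergence \<phi> x"
    by (simp add: divergence_eq[OF d] divergence_eq[OF \<phi>'(1)] D sum.distrib sum_distrib_left
        inner_axis)
qed

lemma C1_compact_support_translate:
  fixes \<phi> :: "real^'n \<Rightarrow> real^'n"
  assumes "C1_compact_support \<phi>"
  shows "C1_compact_support (\<lambda>x. \<phi> (x - a))" "divergence (\<lambda>x. \<phi> (x - a)) x = divergence \<phi> (x - a)"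
proof -
  obtain \<phi>' r where \<phi>': "\<And>x. (\<phi> has_derivative blinfun_apply (\<phi>' x)) (at x)"
    "continuous_on UNIV \<phi>'" "\<And>x. r < norm x \<Longrightarrow> \<phi> x = 0"
    using C1_compact_supportE[OF assms(1)] by metis
  have d: "((\<lambda>x. \<phi> (x - a)) has_derivative blinfun_apply (\<phi>' (x - a))) (at x)" for x
  proof -
    have "((\<lambda>x. x - a) has_derivative (\<lambda>h. h)) (at x)"
      by (auto intro!: derivative_eq_intros)
    from has_derivative_compose[OF this \<phi>'(1)] show ?thesis by simp
  qed
  show "C1_compact_support (\<lambda>x. \<phi> (x - a))"
  proof (rule C1_compact_supportI[OF d, where r = "r + norm a"])
    show "continuous_on UNIV (\<lambda>x. \<phi>' (x - a))"
      by (intro continuous_on_compose2[OF \<phi>'(2)] continuous_intros) auto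
    fix x :: "real^'n" assume "r + norm a < norm x"
    then show "\<phi> (x - a) = 0"
      using norm_triangle_ineq2[of x a] by (intro \<phi>'(3)) linarith
  qed
  show "divergence (\<lambda>x. \<phi> (x - a)) x = divergence \<phi> (x - a)"
    by (simp add: divergence_eq[OF d] divergence_eq[OF \<phi>'(1)])
qed

lemma integral_lborel_translate:
  fixes f :: "'a::euclidean_space \<Rightarrow> 'b::{banach, second_countable_topology}"
  assumes "f \<in> borel_measurable borel"
  shows "(LINT x|lborel. f (a + x)) = (LINT x|lborel. f x)"
proof -
  have "(LINT x|lborel. f x) = (LINT x|distr lborel borel ((+) a). f x)"
    by (simp add: lborel_distr_plus)
  also have "\<dots> = (LINT x|lborel. f (a + x))"
    using assms by (subst integral_distr) auto
  finally show ?thesis by simp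
qed

lemma integrable_lborel_translate:
  fixes f :: "'a::euclidean_space \<Rightarrow> 'b::{banach, second_countable_topology}"
  assumes "integrable lborel f"
  shows "integrable lborel (\<lambda>x. f (a + x))"
proof -
  have "integrable (distr lborel borel ((+) a)) f"
    using assms by (simp add: lborel_distr_plus)
  then show ?thesis
    by (subst (asm) integrable_distr_eq) (use assms in auto)
qed

text \<open>The integral of \<open>\<phi>(x + t h) - \<phi>(x)\<close> over \<open>x\<close> is zero by translation invariance. Dividing by \<open>t\<close> and
letting \<open>t \<rightarrow> 0\<close>, uniformly on a ball containing all supports, shows that every directional
derivative of \<open>\<phi>\<close> integrates to zero.\<close>

lemma integral_divergence_eq_0:
  fixes \<phi> :: "real^'n \<Rightarrow> real^'n"
  assumes "C1_compact_support \<phi>"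
  shows "(LINT x|lborel. divergence \<phi> x) = 0"
proof -
  obtain \<phi>' r where \<phi>': "\<And>x. (\<phi> has_derivative blinfun_apply (\<phi>' x)) (at x)"
    "continuous_on UNIV \<phi>'" "r > 0" "\<And>x. r < norm x \<Longrightarrow> \<phi> x = 0" "\<And>x. r < norm x \<Longrightarrow> \<phi>' x = 0"
    using C1_compact_supportE[OF assms] by metis
  have cont\<phi>: "continuous_on UNIV \<phi>"
    by (rule continuous_on_UNIV_if_has_derivative[OF \<phi>'(1)])
  have int\<phi>: "integrable lborel \<phi>"
    using cont\<phi> \<phi>'(4) by (rule integrable_if_continuous_vanishing_outside_cball)
  have int\<phi>': "integrable lborel (\<lambda>x. blinfun_apply (\<phi>' x) h)" for h
    by (rule integrable_if_continuous_vanishing_outside_cball[where r = r])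
       (use \<phi>'(2,5) in \<open>auto intro!: continuous_intros\<close>)
  have zero: "(LINT x|lborel. blinfun_apply (\<phi>' x) h) = 0" (is "?J = 0") if "norm h = 1" for h
  proof -
    \<comment> \<open>For \<open>norm (t *\<^sub>R h) < 1\<close> this ball contains the supports of \<open>\<phi>\<close> and of its translate.\<close>
    define V where "V = measure lborel (cball (0::real^'n) (r + 1))"
    have "norm ?J \<le> V * e" if "e > 0" for e
    proof -
      obtain d where d: "d > 0"
        "\<And>x h. norm h < d \<Longrightarrow> norm (\<phi> (x + h) - \<phi> x - blinfun_apply (\<phi>' x) h) \<le> e * norm h"
        using uniform_linear_approximation[OF \<phi>'(1)
            uniformly_continuous_on_if_vanishing_outside_cball[OF \<phi>'(2,5)] \<open>e > 0\<close>] by metis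
      define t where "t = min 1 d / 2"
      have t: "0 < t" "t < d" "t < 1" using d(1) by (auto simp: t_def)
      define q where "q x = \<phi> (t *\<^sub>R h + x) - \<phi> x - t *\<^sub>R blinfun_apply (\<phi>' x) h" for x
      have int: "integrable lborel (\<lambda>x. \<phi> (t *\<^sub>R h + x))"
        by (rule integrable_lborel_translate[OF int\<phi>])
      have "(LINT x|lborel. q x) = - t *\<^sub>R ?J"
        unfolding q_def using int int\<phi> int\<phi>'
          integral_lborel_translate[of \<phi> "t *\<^sub>R h"] borel_measurable_continuous_onI[OF cont\<phi>]
        by simp
      moreover have "norm (LINT x|lborel. q x) \<le> V * (e * t)"
      proof -
        have "norm (q x) \<le> indicator (cball 0 (r + 1)) x * (e * t)" for x
        proof (cases "norm x \<le> r + 1")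
          case True
          then show ?thesis using d(2)[of "t *\<^sub>R h" x] t \<open>norm h = 1\<close>
            by (simp add: q_def blinfun.scaleR_right add.commute)
        next
          case False
          have "norm x \<le> norm (t *\<^sub>R h + x) + norm (t *\<^sub>R h)"
            using norm_triangle_ineq2[of x "- t *\<^sub>R h"] by (simp add: add.commute)
          then have "r < norm (t *\<^sub>R h + x)" "r < norm x"
            using False t \<open>norm h = 1\<close> by auto
          then show ?thesis using \<phi>'(4,5) False by (simp add: q_def)
        qed
        then have bound: "norm (q x) \<le> (e * t) *\<^sub>R indicator (cball 0 (r + 1)) x" for x
          by (simp add: mult.commute)
        have "integrable lborel q"
          unfolding q_def using int int\<phi> int\<phi>' by simp
        moreover have "integrable lborel (\<lambda>x::real^'n. (e * t) *\<^sub>R indicat_real (cball 0 (r + 1)) x)"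
          using emeasure_lborel_cball_finite[of "0::real^'n" "r + 1"]
          by (intro integrable_scaleR_right) simp
        ultimately have "norm (LINT x|lborel. q x)
            \<le> (LINT x|lborel. (e * t) *\<^sub>R indicat_real (cball (0::real^'n) (r + 1)) x)"
          by (rule Bochner_Integration.integral_norm_bound_integral) (rule bound)
        then show ?thesis by (simp add: V_def mult.commute)
      qed
      ultimately have "t * norm ?J \<le> t * (V * e)"
        using t(1) by (simp add: algebra_simps)
      then show ?thesis using t(1) by simp
    qed
    moreover have "V \<ge> 0" by (simp add: V_def)
    ultimately have "norm ?J \<le> e" if "e > 0" for e
    proof -
      have "norm ?J \<le> V * (e / (V + 1))"
        using \<open>e > 0\<close> \<open>V \<ge> 0\<close> by (intro \<open>\<And>e. e > 0 \<Longrightarrow> norm ?J \<le> V * e\<close>) simp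
      also have "\<dots> \<le> e"
        using \<open>e > 0\<close> \<open>V \<ge> 0\<close> by (simp add: field_simps)
      finally show ?thesis .
    qed
    then have "norm ?J \<le> 0"
      by (meson dense_ge less_imp_le field_le_epsilon norm_ge_zero order.trans add_0)
    then show ?thesis by simp
  qed
  have "(LINT x|lborel. divergence \<phi> x)
      = (\<Sum>i\<in>UNIV. LINT x|lborel. blinfun_apply (\<phi>' x) (axis i 1) $ i)"
    by (simp add: divergence_eq[OF \<phi>'(1)] integrable_bounded_linear[OF bounded_linear_vec_nth int\<phi>'])
  also have "\<dots> = (\<Sum>i\<in>UNIV. (LINT x|lborel. blinfun_apply (\<phi>' x) (axis i 1)) $ i)"
    by (simp add: integral_bounded_linear[OF bounded_linear_vec_nth int\<phi>'])
  also have "\<dots> = 0"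
    by (simp add: zero norm_axis_1)
  finally show ?thesis .
qed

section \<open>Splitting the total variation of a C1 function at a level\<close>

lemma le_if_le_add_mult_epsilon:
  fixes a b C :: real
  assumes "\<And>e. e > 0 \<Longrightarrow> a \<le> b + C * e"
  shows "a \<le> b"
proof (rule tendsto_lowerbound)
  show "((\<lambda>e. b + C * e) \<longlongrightarrow> b) (at_right 0)"
    by (rule tendsto_eq_intros refl)+ simp
  show "\<forall>\<^sub>F e in at_right 0. a \<le> b + C * e"
    using assms eventually_at_right_less[of "0::real"] by (auto elim: eventually_mono)
qed simp

definition unit_field :: "(real^'n \<Rightarrow> real^'n) \<Rightarrow> bool" where
  "unit_field \<phi> \<longleftrightarrow> C1_compact_support \<phi> \<and> (\<forall>x. norm (\<phi> x) \<le> 1)"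

lemma unit_fieldD: "unit_field \<phi> \<Longrightarrow> C1_compact_support \<phi>" "unit_field \<phi> \<Longrightarrow> norm (\<phi> x) \<le> 1"
  by (auto simp: unit_field_def)

lemma unit_field_zero: "unit_field (\<lambda>_. 0)"
  unfolding unit_field_def
  by (auto intro!: C1_compact_supportI[where \<phi>' = "\<lambda>_. 0" and r = 0] simp: zero_blinfun.rep_eq)

lemma total_variation_eq_lborel:
  fixes f :: "real^'n \<Rightarrow> real"
  assumes [measurable]: "f \<in> borel_measurable borel"
  shows "total_variation f = (SUP \<phi>\<in>{\<phi>. unit_field \<phi>}. ereal (LINT x|lborel. f x * divergence \<phi> x))"
  unfolding total_variation_def unit_field_def
proof (rule SUP_cong[OF refl])
  fix \<phi> :: "real^'n \<Rightarrow> real^'n"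
  assume "\<phi> \<in> {\<phi>. C1_compact_support \<phi> \<and> (\<forall>x. norm (\<phi> x) \<le> 1)}"
  then have [measurable]: "divergence \<phi> \<in> borel_measurable borel"
    by (auto intro: borel_measurable_divergence)
  show "ereal (LINT x|lebesgue. f x * divergence \<phi> x) = ereal (LINT x|lborel. f x * divergence \<phi> x)"
    by (subst integral_completion) simp_all
qed

lemma total_variation_upper:
  assumes "f \<in> borel_measurable borel" "unit_field \<phi>"
  shows "ereal (LINT x|lborel. f x * divergence \<phi> x) \<le> total_variation f"
  using assms(2) unfolding total_variation_eq_lborel[OF assms(1)] by (intro SUP_upper) simp

lemma total_variation_nonneg:
  fixes f :: "real^'n \<Rightarrow> real"
  shows "0 \<le> total_variation f"
proof -
  have "divergence (\<lambda>_. 0::real^'n) x = 0" for x :: "real^'n"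
    using divergence_eq[of "\<lambda>_. 0::real^'n" 0 x] by (simp add: zero_blinfun.rep_eq)
  then have "ereal (LINT x|lebesgue. f x * divergence (\<lambda>_. 0) x) = 0"
    by (simp add: zero_ereal_def)
  moreover have "ereal (LINT x|lebesgue. f x * divergence (\<lambda>_. 0) x) \<le> total_variation f"
    unfolding total_variation_def using unit_field_zero by (intro SUP_upper) (simp add: unit_field_def)
  ultimately show ?thesis by metis
qed

text \<open>Formally both sides are \<open>- \<integral> F1(u) \<nabla>u \<bullet> \<phi>\<close>. They are compared directly: their difference is
the integral of the divergence of \<open>(u F1(u) - F(u)) \<phi>\<close>, a compactly supported field although \<open>u\<close>
itself need not vanish anywhere.\<close>

lemma integral_composition_divergence:
  fixes u :: "real^'n \<Rightarrow> real" and U :: "real^'n \<Rightarrow> real^'n"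
  assumes u: "\<And>x. (u has_derivative (\<lambda>h. U x \<bullet> h)) (at x)" and U: "continuous_on UNIV U"
    and F: "\<And>t. (F has_real_derivative F1 t) (at t)"
    and F1: "\<And>t. (F1 has_real_derivative F2 t) (at t)" and F2: "continuous_on UNIV F2"
    and \<phi>: "C1_compact_support \<phi>"
  shows "C1_compact_support (\<lambda>x. F1 (u x) *\<^sub>R \<phi> x)"
    "(LINT x|lborel. F (u x) * divergence \<phi> x)
      = (LINT x|lborel. u x * divergence (\<lambda>x. F1 (u x) *\<^sub>R \<phi> x) x)"
proof -
  have contu: "continuous_on UNIV u"
    by (rule continuous_on_UNIV_if_has_derivative[OF u])
  have contF: "continuous_on UNIV F"
    by (auto intro!: continuous_at_imp_continuous_on intro: DERIV_isCont F)
  have compose: "((\<lambda>x. G (u x)) has_derivative (\<lambda>h. (g (u x) *\<^sub>R U x) \<bullet> h)) (at x)"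
    if "\<And>t. (G has_real_derivative g t) (at t)" for G g x
    using has_derivative_compose[OF u, of G "(*) (g (u x))" x] that[of "u x"]
    by (simp add: has_field_derivative_def)
  have cont_compose: "continuous_on UNIV (\<lambda>x. G (u x))" if "continuous_on UNIV G" for G :: "real \<Rightarrow> real"
    by (rule continuous_on_compose2[OF that contu]) auto
  have c1: "continuous_on UNIV (\<lambda>x. F2 (u x) *\<^sub>R U x)"
    by (intro continuous_on_scaleR cont_compose F2 U)
  note A = C1_compact_support_scaleR[OF \<phi> compose[OF F1] c1]
  show "C1_compact_support (\<lambda>x. F1 (u x) *\<^sub>R \<phi> x)" by (rule A(1))
  have dw: "((\<lambda>t. t * F1 t - F t) has_real_derivative t * F2 t) (at t)" for t
    by (rule derivative_eq_intros F F1 refl)+ simp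
  have c2: "continuous_on UNIV (\<lambda>x. (u x * F2 (u x)) *\<^sub>R U x)"
    by (intro continuous_on_scaleR continuous_on_mult contu cont_compose F2 U)
  note B = C1_compact_support_scaleR[OF \<phi> compose[OF dw] c2]
  obtain r where r: "\<And>x. r < norm x \<Longrightarrow> divergence \<phi> x = 0" "continuous_on UNIV (divergence \<phi>)"
    using divergenceE[OF \<phi>] by metis
  obtain r' where r': "\<And>x. r' < norm x \<Longrightarrow> divergence (\<lambda>x. F1 (u x) *\<^sub>R \<phi> x) x = 0"
     "continuous_on UNIV (divergence (\<lambda>x. F1 (u x) *\<^sub>R \<phi> x))"
    using divergenceE[OF A(1)] by metis
  have i1: "integrable lborel (\<lambda>x. F (u x) * divergence \<phi> x)"
    by (rule integrable_if_continuous_vanishing_outside_cball[where r = r])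
       (auto intro!: continuous_on_mult cont_compose contF r)
  have i2: "integrable lborel (\<lambda>x. u x * divergence (\<lambda>x. F1 (u x) *\<^sub>R \<phi> x) x)"
    by (rule integrable_if_continuous_vanishing_outside_cball[where r = r'])
       (auto intro!: continuous_on_mult contu r')
  have "(LINT x|lborel. u x * divergence (\<lambda>x. F1 (u x) *\<^sub>R \<phi> x) x) - (LINT x|lborel. F (u x) * divergence \<phi> x)
     = (LINT x|lborel. u x * divergence (\<lambda>x. F1 (u x) *\<^sub>R \<phi> x) x - F (u x) * divergence \<phi> x)"
    using i1 i2 by simp
  also have "\<dots> = (LINT x|lborel. divergence (\<lambda>x. (u x * F1 (u x) - F (u x)) *\<^sub>R \<phi> x) x)"
    unfolding A(2) B(2) by (intro Bochner_Integration.integral_cong refl) (simp add: algebra_simps)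
  also have "\<dots> = 0"
    by (rule integral_divergence_eq_0[OF B(1)])
  finally show "(LINT x|lborel. F (u x) * divergence \<phi> x)
      = (LINT x|lborel. u x * divergence (\<lambda>x. F1 (u x) *\<^sub>R \<phi> x) x)" by simp
qed

text \<open>Since \<open>F1\<close> takes values in \<open>[0, 1]\<close>, the field \<open>F1(u) \<phi> + (1 - F1(u)) \<psi>\<close> is a pointwise convex combination, hence again a competitor in
the supremum that defines the total variation of \<open>u\<close>. Tested with it, \<open>u\<close> decomposes into \<open>F(u)\<close>
tested with \<open>\<phi>\<close> and \<open>u - F(u)\<close> tested with \<open>\<psi>\<close>.\<close>

lemma total_variation_ge_smooth_splitting:
  fixes u :: "real^'n \<Rightarrow> real" and U :: "real^'n \<Rightarrow> real^'n"
  assumes u: "\<And>x. (u has_derivative (\<lambda>h. U x \<bullet> h)) (at x)" and U: "continuous_on UNIV U"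
    and F: "\<And>t. (F has_real_derivative F1 t) (at t)"
    and F1: "\<And>t. (F1 has_real_derivative F2 t) (at t)" and F2: "continuous_on UNIV F2"
    and F1_01: "\<And>t. 0 \<le> F1 t \<and> F1 t \<le> 1"
    and \<phi>: "unit_field \<phi>" and \<psi>: "unit_field \<psi>"
  shows "ereal ((LINT x|lborel. F (u x) * divergence \<phi> x) + (LINT x|lborel. (u x - F (u x)) * divergence \<psi> x))
    \<le> total_variation u"
proof -
  have contu: "continuous_on UNIV u"
    by (rule continuous_on_UNIV_if_has_derivative[OF u])
  note A = integral_composition_divergence[OF u U F F1 F2 unit_fieldD(1)[OF \<phi>]]
  have "((\<lambda>t. t - F t) has_real_derivative 1 - F1 t) (at t)"
    "((\<lambda>t. 1 - F1 t) has_real_derivative - F2 t) (at t)" for t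
    by (auto intro!: derivative_eq_intros F F1)
  note B = integral_composition_divergence[OF u U this continuous_on_minus[OF F2] unit_fieldD(1)[OF \<psi>]]
  note C = C1_compact_support_add[OF A(1) B(1)]
  let ?\<eta> = "\<lambda>x. F1 (u x) *\<^sub>R \<phi> x + (1 - F1 (u x)) *\<^sub>R \<psi> x"
  have int: "integrable lborel (\<lambda>x. u x * divergence \<zeta> x)" if \<zeta>: "C1_compact_support \<zeta>" for \<zeta>
  proof -
    obtain r where "\<And>x. r < norm x \<Longrightarrow> divergence \<zeta> x = 0" "continuous_on UNIV (divergence \<zeta>)"
      using divergenceE[OF \<zeta>] by metis
    then show ?thesis
      by (intro integrable_if_continuous_vanishing_outside_cball[where r = r])
         (auto intro!: continuous_on_mult contu)
  qed
  have "norm (?\<eta> x) \<le> 1" for x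
  proof -
    have "norm (?\<eta> x) \<le> F1 (u x) * norm (\<phi> x) + (1 - F1 (u x)) * norm (\<psi> x)"
      using F1_01[of "u x"] norm_triangle_ineq[of "F1 (u x) *\<^sub>R \<phi> x" "(1 - F1 (u x)) *\<^sub>R \<psi> x"] by simp
    also have "\<dots> \<le> F1 (u x) * 1 + (1 - F1 (u x)) * 1"
      using F1_01[of "u x"] unit_fieldD(2)[OF \<phi>] unit_fieldD(2)[OF \<psi>]
      by (intro add_mono mult_left_mono) auto
    finally show ?thesis by simp
  qed
  with C(1) have "unit_field ?\<eta>" by (simp add: unit_field_def)
  then have "ereal (LINT x|lborel. u x * divergence ?\<eta> x) \<le> total_variation u"
    by (intro total_variation_upper borel_measurable_continuous_onI contu)
  moreover have "(LINT x|lborel. u x * divergence ?\<eta> x)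
      = (LINT x|lborel. F (u x) * divergence \<phi> x) + (LINT x|lborel. (u x - F (u x)) * divergence \<psi> x)"
    unfolding A(2) B(2) C(2) using int[OF A(1)] int[OF B(1)] by (simp add: distrib_left)
  ultimately show ?thesis by simp
qed

text \<open>The smooth splitting is applied with \<open>F t = (t + c - sqrt ((t - c)\<^sup>2 + \<delta>\<^sup>2)) / 2\<close>. For \<open>\<delta> = 0\<close> this
would be \<open>min t c\<close>; the error is at most \<open>\<delta>\<close> uniformly in \<open>t\<close>, and \<open>\<delta>\<close> is arbitrary.\<close>

lemma total_variation_ge_truncations_if_C1:
  fixes u :: "real^'n \<Rightarrow> real" and U :: "real^'n \<Rightarrow> real^'n"
  assumes u: "\<And>x. (u has_derivative (\<lambda>h. U x \<bullet> h)) (at x)" and U: "continuous_on UNIV U"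
    and \<phi>: "unit_field \<phi>" and \<psi>: "unit_field \<psi>"
  shows "ereal ((LINT x|lborel. min (u x) c * divergence \<phi> x) + (LINT x|lborel. max (u x - c) 0 * divergence \<psi> x))
    \<le> total_variation u"
proof (cases "total_variation u")
  case (real T)
  have contu: "continuous_on UNIV u"
    by (rule continuous_on_UNIV_if_has_derivative[OF u])
  have int: "integrable lborel (\<lambda>x. v x * divergence \<zeta> x)" "integrable lborel (\<lambda>x. \<bar>divergence \<zeta> x\<bar>)"
    if v: "continuous_on UNIV v" and \<zeta>: "unit_field \<zeta>" for v and \<zeta> :: "real^'n \<Rightarrow> real^'n"
  proof -
    obtain r where "\<And>x. r < norm x \<Longrightarrow> divergence \<zeta> x = 0" "continuous_on UNIV (divergence \<zeta>)"
      using divergenceE[OF unit_fieldD(1)[OF \<zeta>]] by metis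
    then show "integrable lborel (\<lambda>x. v x * divergence \<zeta> x)" "integrable lborel (\<lambda>x. \<bar>divergence \<zeta> x\<bar>)"
      using v by (auto intro!: integrable_if_continuous_vanishing_outside_cball[where r = r]
          continuous_on_mult continuous_on_rabs)
  qed
  define C where "C = (LINT x|lborel. \<bar>divergence \<phi> x\<bar>) + (LINT x|lborel. \<bar>divergence \<psi> x\<bar>)"
  have "(LINT x|lborel. min (u x) c * divergence \<phi> x) + (LINT x|lborel. max (u x - c) 0 * divergence \<psi> x)
     \<le> T + C * \<delta>" if "\<delta> > 0" for \<delta>
  proof -
    \<comment> \<open>A C1 substitute for \<open>\<bar>t - c\<bar>\<close>; \<open>F1\<close> and \<open>F2\<close> are the first two derivatives of \<open>F\<close>.\<close>
    define s where "s t = sqrt ((t - c)\<^sup>2 + \<delta>\<^sup>2)" for t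
    have pos: "0 < (t - c)\<^sup>2 + \<delta>\<^sup>2" for t
      using \<open>\<delta> > 0\<close> by (simp add: add_nonneg_pos)
    then have s_pos: "0 < s t" and s_sq: "(s t)\<^sup>2 = (t - c)\<^sup>2 + \<delta>\<^sup>2" for t
      by (auto simp: s_def less_imp_le)
    have s_abs: "\<bar>t - c\<bar> \<le> s t" "s t \<le> \<bar>t - c\<bar> + \<delta>" for t
    proof -
      show "\<bar>t - c\<bar> \<le> s t"
        unfolding s_def by (rule real_sqrt_ge_abs1)
      show "s t \<le> \<bar>t - c\<bar> + \<delta>"
        unfolding s_def using \<open>\<delta> > 0\<close> sqrt_sum_squares_le_sum_abs[of "t - c" \<delta>] by simp
    qed
    define F where "F t = (t + c - s t) / 2" for t
    define F1 where "F1 t = (1 - (t - c) / s t) / 2" for t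
    define F2 where "F2 t = - (\<delta>\<^sup>2 / (s t) ^ 3) / 2" for t
    have ds: "(s has_real_derivative (t - c) / s t) (at t)" for t
      unfolding s_def using pos[of t]
      by (auto intro!: derivative_eq_intros simp: divide_simps)
    have dF: "(F has_real_derivative F1 t) (at t)" for t
      unfolding F_def F1_def by (auto intro!: derivative_eq_intros ds)
    have dF1: "(F1 has_real_derivative F2 t) (at t)" for t
    proof -
      have "(1 * s t - (t - c) * ((t - c) / s t)) / (s t * s t) = \<delta>\<^sup>2 / (s t) ^ 3"
        using s_pos[of t] s_sq[of t] by (simp add: field_simps power2_eq_square power3_eq_cube)
      then show ?thesis
        unfolding F1_def F2_def using s_pos[of t]
        by (auto intro!: derivative_eq_intros ds)
    qed
    have cs: "continuous_on UNIV s"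
      by (auto intro!: continuous_at_imp_continuous_on intro: DERIV_isCont ds)
    have cF2: "continuous_on UNIV F2"
      unfolding F2_def using cs s_pos by (auto intro!: continuous_intros simp: less_imp_neq[symmetric])
    have F1_01: "0 \<le> F1 t \<and> F1 t \<le> 1" for t
    proof -
      have "\<bar>(t - c) / s t\<bar> \<le> 1"
        using s_abs(1)[of t] s_pos[of t] by (simp add: abs_divide)
      then have "(t - c) / s t \<le> 1" "- 1 \<le> (t - c) / s t" unfolding abs_le_iff by linarith+
      then show ?thesis unfolding F1_def by simp
    qed
    have close: "\<bar>F t - min t c\<bar> \<le> \<delta>" "\<bar>(t - F t) - max (t - c) 0\<bar> \<le> \<delta>" for t
      using s_abs[of t] \<open>\<delta> > 0\<close> by (auto simp: F_def min_def max_def field_simps)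
    have cF: "continuous_on UNIV (\<lambda>x. F (u x))"
      unfolding F_def by (intro continuous_intros contu continuous_on_compose2[OF cs contu]) auto
    have perturb: "(LINT x|lborel. v x * divergence \<zeta> x)
        \<le> (LINT x|lborel. w x * divergence \<zeta> x) + (LINT x|lborel. \<bar>divergence \<zeta> x\<bar>) * \<delta>"
      if "continuous_on UNIV v" "continuous_on UNIV w" "\<And>x. \<bar>w x - v x\<bar> \<le> \<delta>" "unit_field \<zeta>"
      for v w and \<zeta> :: "real^'n \<Rightarrow> real^'n"
    proof -
      have "v x * divergence \<zeta> x \<le> w x * divergence \<zeta> x + \<bar>divergence \<zeta> x\<bar> * \<delta>" for x
      proof -
        have "(v x - w x) * divergence \<zeta> x \<le> \<bar>v x - w x\<bar> * \<bar>divergence \<zeta> x\<bar>"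
          by (metis abs_ge_self abs_mult)
        also have "\<dots> \<le> \<delta> * \<bar>divergence \<zeta> x\<bar>"
          using that(3)[of x] by (intro mult_right_mono) auto
        finally show ?thesis by (simp add: algebra_simps)
      qed
      then have "(LINT x|lborel. v x * divergence \<zeta> x)
          \<le> (LINT x|lborel. w x * divergence \<zeta> x + \<bar>divergence \<zeta> x\<bar> * \<delta>)"
        using int[OF that(1,4)] int[OF that(2,4)] by (intro Bochner_Integration.integral_mono) auto
      then show ?thesis using int[OF that(1,4)] int[OF that(2,4)] by simp
    qed
    have "(LINT x|lborel. min (u x) c * divergence \<phi> x) \<le> (LINT x|lborel. F (u x) * divergence \<phi> x)
        + (LINT x|lborel. \<bar>divergence \<phi> x\<bar>) * \<delta>"
      by (rule perturb) (auto intro!: continuous_intros contu cF close \<phi>)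
    moreover have "(LINT x|lborel. max (u x - c) 0 * divergence \<psi> x)
       \<le> (LINT x|lborel. (u x - F (u x)) * divergence \<psi> x)
        + (LINT x|lborel. \<bar>divergence \<psi> x\<bar>) * \<delta>"
      by (rule perturb) (auto intro!: continuous_intros contu cF close \<psi>)
    moreover have "(LINT x|lborel. F (u x) * divergence \<phi> x) + (LINT x|lborel. (u x - F (u x)) * divergence \<psi> x) \<le> T"
      using total_variation_ge_smooth_splitting[OF u U dF dF1 cF2 F1_01 \<phi> \<psi>] real by simp
    ultimately show ?thesis by (simp add: C_def algebra_simps)
  qed
  then have "(LINT x|lborel. min (u x) c * divergence \<phi> x) + (LINT x|lborel. max (u x - c) 0 * divergence \<psi> x) \<le> T"
    by (rule le_if_le_add_mult_epsilon)
  then show ?thesis using real by simp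
qed (use total_variation_nonneg[of u] in auto)

section \<open>Mollification\<close>

lemma has_real_derivative_square_of_positive_part:
  "((\<lambda>t. (max 0 t)\<^sup>2) has_real_derivative 2 * max 0 t) (at (t::real))"
proof -
  consider "t > 0" | "t < 0" | "t = 0" by linarith
  then show ?thesis
  proof cases
    case 1
    have "((\<lambda>t. t\<^sup>2) has_real_derivative 2 * max 0 t) (at t)"
      using 1 by (auto intro!: derivative_eq_intros)
    then show ?thesis
      by (rule has_field_derivative_transform_within_open[where S = "{0<..}"]) (use 1 in auto)
  next
    case 2
    have "((\<lambda>t. 0) has_real_derivative 2 * max 0 t) (at t)"
      using 2 by simp
    then show ?thesis
      by (rule has_field_derivative_transform_within_open[where S = "{..<0}"]) (use 2 in auto)
  next
    case 3
    have "((\<lambda>y::real. max 0 y) \<longlongrightarrow> 0) (at 0)"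
      by (rule tendsto_eq_intros refl)+ simp
    moreover have "\<forall>\<^sub>F y in at (0::real). ((max 0 y)\<^sup>2 - (max 0 0)\<^sup>2) / (y - 0) = max 0 y"
      by (auto simp: eventually_at_filter max_def power2_eq_square)
    ultimately have "((\<lambda>y::real. ((max 0 y)\<^sup>2 - (max 0 0)\<^sup>2) / (y - 0)) \<longlongrightarrow> 0) (at 0)"
      by (simp cong: filterlim_cong)
    then show ?thesis using 3 by (simp add: has_field_derivative_iff)
  qed
qed

text \<open>The gradient \<open>G\<close> is a parameter because the gradient of a convolution with \<open>\<rho>\<close> is a convolution
with \<open>G\<close>.\<close>

definition C1_mollifier :: "real \<Rightarrow> ('a::euclidean_space \<Rightarrow> real) \<Rightarrow> ('a \<Rightarrow> 'a) \<Rightarrow> bool" where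
  "C1_mollifier r \<rho> G \<longleftrightarrow>
     (\<forall>x. (\<rho> has_derivative (\<lambda>h. G x \<bullet> h)) (at x)) \<and> continuous_on UNIV G \<and>
     (\<forall>x. r < norm x \<longrightarrow> \<rho> x = 0 \<and> G x = 0) \<and> (\<forall>x. 0 \<le> \<rho> x) \<and> (LINT x|lborel. \<rho> x) = 1"

lemma C1_mollifierD:
  assumes "C1_mollifier r \<rho> G"
  shows "(\<rho> has_derivative (\<lambda>h. G x \<bullet> h)) (at x)" "continuous_on UNIV G"
    "r < norm x \<Longrightarrow> \<rho> x = 0" "r < norm x \<Longrightarrow> G x = 0" "0 \<le> \<rho> x" "(LINT x|lborel. \<rho> x) = 1"
  using assms by (auto simp: C1_mollifier_def)

text \<open>The bump \<open>(max 0 (r\<^sup>2 - \<bar>x\<bar>\<^sup>2))\<^sup>2\<close>, normalised. The outer square makes it differentiable across the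
sphere of radius \<open>r\<close>.\<close>

lemma C1_mollifier_exists:
  assumes "r > 0"
  obtains \<rho> :: "'a::euclidean_space \<Rightarrow> real" and G where "C1_mollifier r \<rho> G"
proof -
  define b :: "'a \<Rightarrow> real" where "b x = (max 0 (r\<^sup>2 - x \<bullet> x))\<^sup>2" for x
  define g :: "'a \<Rightarrow> 'a" where "g x = (- 4 * max 0 (r\<^sup>2 - x \<bullet> x)) *\<^sub>R x" for x
  have db: "(b has_derivative (\<lambda>h. g x \<bullet> h)) (at x)" for x
  proof -
    have "((\<lambda>x. r\<^sup>2 - x \<bullet> x) has_derivative (\<lambda>h. - 2 * (x \<bullet> h))) (at x)"
      by (auto intro!: derivative_eq_intros simp: inner_commute)
    from has_derivative_compose[OF this
        has_real_derivative_square_of_positive_part[unfolded has_field_derivative_def]]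
    show ?thesis by (simp add: b_def[abs_def] g_def algebra_simps)
  qed
  have contg: "continuous_on UNIV g"
    unfolding g_def by (intro continuous_intros)
  have contb: "continuous_on UNIV b"
    unfolding b_def by (intro continuous_intros)
  have outside: "max 0 (r\<^sup>2 - x \<bullet> x) = 0" if "r < norm x" for x :: 'a
    using that \<open>r > 0\<close> power_mono[of r "norm x" 2] by (simp add: power2_norm_eq_inner)
  have zerob: "b x = 0" if "r < norm x" for x using outside[OF that] by (simp add: b_def)
  have zerog: "g x = 0" if "r < norm x" for x using outside[OF that] by (simp add: g_def)
  have intb: "integrable lborel b"
    by (rule integrable_if_continuous_vanishing_outside_cball[OF contb zerob])
  define M where "M = (LINT x|lborel. b x)"
  have "M > 0"
  proof -
    have le: "(3 / 4 * r\<^sup>2)\<^sup>2 *\<^sub>R indicat_real (ball (0::'a) (r / 2)) x \<le> b x" for x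
    proof (cases "norm x < r / 2")
      case True
      then have "(norm x)\<^sup>2 \<le> (r / 2)\<^sup>2" by (intro power_mono) auto
      then have "3 / 4 * r\<^sup>2 \<le> r\<^sup>2 - x \<bullet> x"
        by (simp add: power2_norm_eq_inner power_divide)
      then have "3 / 4 * r\<^sup>2 \<le> max 0 (r\<^sup>2 - x \<bullet> x)"
        by (rule max.coboundedI2)
      then have "(3 / 4 * r\<^sup>2)\<^sup>2 \<le> b x"
        unfolding b_def using \<open>r > 0\<close> by (intro power_mono) auto
      then show ?thesis by (simp add: indicator_def b_def)
    qed (simp add: b_def)
    have "0 < (3 / 4 * r\<^sup>2)\<^sup>2 * measure lborel (ball (0::'a) (r / 2))"
      using \<open>r > 0\<close> content_ball_pos[of "r / 2" "0::'a"] by simp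
    also have "\<dots> = (LINT x|lborel. (3 / 4 * r\<^sup>2)\<^sup>2 *\<^sub>R indicat_real (ball (0::'a) (r / 2)) x)"
      by simp
    also have "\<dots> \<le> M"
      unfolding M_def
      using emeasure_lborel_ball_finite[of "0::'a" "r / 2"] intb le
      by (intro Bochner_Integration.integral_mono integrable_scaleR_right) auto
    finally show ?thesis .
  qed
  have "C1_mollifier r (\<lambda>x. b x / M) (\<lambda>x. g x /\<^sub>R M)"
    unfolding C1_mollifier_def
  proof (intro conjI allI impI)
    show "((\<lambda>x. b x / M) has_derivative (\<lambda>h. (g x /\<^sub>R M) \<bullet> h)) (at x)" for x
      using has_derivative_mult_right[OF db, of "inverse M" x] by (simp add: divide_inverse mult.commute)
    show "continuous_on UNIV (\<lambda>x. g x /\<^sub>R M)" by (intro continuous_intros contg)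
    show "(LINT x|lborel. b x / M) = 1" using \<open>M > 0\<close> by (simp add: M_def[symmetric])
    show "0 \<le> b x / M" for x using \<open>M > 0\<close> by (simp add: b_def)
  qed (simp_all add: zerob zerog)
  then show thesis by (rule that)
qed

text \<open>Fubini's theorem for averages with a probability density \<open>\<rho>\<close>. It serves twice for mollification:
with \<open>H x y = f (y + x) * div \<phi> x\<close> it shows that the total variation does not increase, and with
\<open>H x y = \<bar>f (y + x) - f x\<bar>\<close> it bounds the distance to \<open>f\<close> in L1.\<close>

lemma weighted_average_le:
  fixes H :: "'a::euclidean_space \<Rightarrow> 'a \<Rightarrow> real"
  assumes \<rho>: "continuous_on UNIV \<rho>" "\<And>y. r < norm y \<Longrightarrow> \<rho> y = 0" "\<And>y. 0 \<le> \<rho> y" "(LINT y|lborel. \<rho> y) = 1"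
    and H[measurable]: "(\<lambda>(x, y). H x y) \<in> borel_measurable (borel \<Otimes>\<^sub>M borel)"
    and B: "\<And>x y. \<bar>H x y\<bar> \<le> B" and zero: "\<And>x y. norm y \<le> r \<Longrightarrow> K < norm x \<Longrightarrow> H x y = 0"
    and le: "\<And>y. norm y \<le> r \<Longrightarrow> (LINT x|lborel. H x y) \<le> T"
  shows "integrable lborel (\<lambda>x. LINT y|lborel. \<rho> y * H x y)"
    "(LINT x|lborel. LINT y|lborel. \<rho> y * H x y) \<le> T"
proof -
  have \<rho>m[measurable]: "\<rho> \<in> borel_measurable borel"
    using \<rho>(1) by (rule borel_measurable_continuous_onI)
  have int\<rho>: "integrable lborel \<rho>"
    by (rule integrable_if_continuous_vanishing_outside_cball[OF \<rho>(1,2)])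
  have "bounded (\<rho> ` cball 0 r)"
    by (intro compact_imp_bounded compact_continuous_image continuous_on_subset[OF \<rho>(1)]) auto
  then obtain C where C: "C > 0" "\<And>y. norm y \<le> r \<Longrightarrow> \<bar>\<rho> y\<bar> \<le> C"
    unfolding bounded_pos by auto
  let ?S = "cball 0 K \<times> cball 0 r :: ('a \<times> 'a) set"
  have int: "integrable (lborel \<Otimes>\<^sub>M lborel) (case_prod (\<lambda>x y. \<rho> y * H x y))"
  proof (rule integrableI_bounded_set[where A = ?S and B = "C * B"])
    show "?S \<in> sets (lborel \<Otimes>\<^sub>M lborel)" by measurable
    show "(\<lambda>(x, y). \<rho> y * H x y) \<in> borel_measurable (lborel \<Otimes>\<^sub>M lborel)" by measurable
    show "emeasure (lborel \<Otimes>\<^sub>M lborel) ?S < \<infinity>"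
      unfolding lborel_prod by (intro emeasure_bounded_finite bounded_Times bounded_cball)
    have "\<bar>\<rho> y * H x y\<bar> \<le> C * B" if "norm y \<le> r" for x y
      unfolding abs_mult using C(2)[OF that] B[of x y] C(1) by (intro mult_mono) auto
    then show "AE x in lborel \<Otimes>\<^sub>M lborel. x \<in> ?S \<longrightarrow> norm (case x of (x, y) \<Rightarrow> \<rho> y * H x y) \<le> C * B"
      by (intro AE_I2) auto
    have "(case z of (x, y) \<Rightarrow> \<rho> y * H x y) = 0" if "z \<notin> ?S" for z
      using that \<rho>(2)[of "snd z"] zero[of "snd z" "fst z"]
      by (cases "r < norm (snd z)") (auto simp: case_prod_beta mem_Times_iff)
    then show "AE z in lborel \<Otimes>\<^sub>M lborel. z \<notin> ?S \<longrightarrow> (case z of (x, y) \<Rightarrow> \<rho> y * H x y) = 0"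
      by simp
  qed
  show "integrable lborel (\<lambda>x. LINT y|lborel. \<rho> y * H x y)"
    using lborel_pair.integrable_fst'[OF int] by simp
  have "(LINT x|lborel. LINT y|lborel. \<rho> y * H x y) = (LINT y|lborel. LINT x|lborel. \<rho> y * H x y)"
    by (rule lborel_pair.Fubini_integral[OF int, symmetric])
  also have "\<dots> \<le> (LINT y|lborel. T * \<rho> y)"
  proof (rule Bochner_Integration.integral_mono)
    show "integrable lborel (\<lambda>y. LINT x|lborel. \<rho> y * H x y)"
      by (rule lborel_pair.integrable_snd[OF int])
    show "integrable lborel (\<lambda>y. T * \<rho> y)" using int\<rho> by simp
    show "(LINT x|lborel. \<rho> y * H x y) \<le> T * \<rho> y" for y
      using mult_right_mono[OF le[of y] \<rho>(3)[of y]] \<rho>(2)[of y]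
      by (cases "norm y \<le> r") (auto simp: mult.commute)
  qed
  also have "\<dots> = T" using \<rho>(4) by simp
  finally show "(LINT x|lborel. LINT y|lborel. \<rho> y * H x y) \<le> T" .
qed

lemma integrable_scaleR_bounded_continuous:
  fixes g :: "'a::euclidean_space \<Rightarrow> 'b::{banach, second_countable_topology}"
  assumes f: "integrable lborel f" and g: "continuous_on UNIV g" and B: "\<And>x. norm (g x) \<le> B"
  shows "integrable lborel (\<lambda>x. f x *\<^sub>R g x)"
proof (rule Bochner_Integration.integrable_bound)
  show "integrable lborel (\<lambda>x. B * f x)" using f by simp
  show "(\<lambda>x. f x *\<^sub>R g x) \<in> borel_measurable lborel"
    using f borel_measurable_continuous_onI[OF g] by measurable
  have "0 \<le> B" using B[of 0] norm_ge_zero order_trans by blast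
  show "AE x in lborel. norm (f x *\<^sub>R g x) \<le> norm (B * f x)"
    using mult_left_mono[OF B, of "\<bar>f x\<bar>" x for x] \<open>0 \<le> B\<close> by (intro AE_I2) (simp add: abs_mult mult.commute)
qed

lemma continuous_bounded_if_vanishing_outside_cball:
  fixes g :: "'a::euclidean_space \<Rightarrow> 'b::real_normed_vector"
  assumes "continuous_on UNIV g" "\<And>x. r < norm x \<Longrightarrow> g x = 0"
  obtains B where "B > 0" "\<And>x. norm (g x) \<le> B"
proof -
  have "bounded (g ` cball 0 r)"
    by (intro compact_imp_bounded compact_continuous_image continuous_on_subset[OF assms(1)]) auto
  then obtain B where B: "B > 0" "\<And>x. norm x \<le> r \<Longrightarrow> norm (g x) \<le> B"
    unfolding bounded_pos by auto
  have "norm (g x) \<le> B" for x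
    using B assms(2)[of x] by (cases "norm x \<le> r") auto
  with B(1) show thesis by (rule that)
qed

text \<open>The function \<open>f\<close> is merely integrable, so the regularity comes from the kernel alone: the uniform
linear approximation of \<open>\<rho>\<close> and the uniform continuity of \<open>G\<close> survive integration against \<open>f\<close>.\<close>

lemma convolution_C1:
  fixes f :: "'a::euclidean_space \<Rightarrow> real"
  assumes f: "integrable lborel f"
    and \<rho>: "\<And>x. (\<rho> has_derivative (\<lambda>h. G x \<bullet> h)) (at x)" and G: "continuous_on UNIV G"
    and zero: "\<And>x. r < norm x \<Longrightarrow> \<rho> x = 0" "\<And>x. r < norm x \<Longrightarrow> G x = 0"
  shows "((\<lambda>x. LINT y|lborel. f y * \<rho> (y - x)) has_derivative
      (\<lambda>h. (LINT y|lborel. f y *\<^sub>R (- G (y - x))) \<bullet> h)) (at x)" (is "(?u has_derivative (\<lambda>h. ?U x \<bullet> h)) _")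
    and "continuous_on UNIV (\<lambda>x. LINT y|lborel. f y *\<^sub>R (- G (y - x)))"
proof -
  have cont\<rho>: "continuous_on UNIV \<rho>"
    by (rule continuous_on_UNIV_if_has_derivative[OF \<rho>])
  obtain B1 where B1: "\<And>x. norm (\<rho> x) \<le> B1"
    using continuous_bounded_if_vanishing_outside_cball[OF cont\<rho> zero(1)] by metis
  obtain B2 where B2: "\<And>x. norm (G x) \<le> B2"
    using continuous_bounded_if_vanishing_outside_cball[OF G zero(2)] by metis
  have int\<rho>: "integrable lborel (\<lambda>y. f y * \<rho> (y - x))" for x
  proof -
    have "continuous_on UNIV (\<lambda>y. \<rho> (y - x))"
      by (intro continuous_on_compose2[OF cont\<rho>] continuous_intros) auto
    from integrable_scaleR_bounded_continuous[OF f this B1] show ?thesis by simp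
  qed
  have intG: "integrable lborel (\<lambda>y. f y *\<^sub>R (- G (y - x)))" for x
    by (rule integrable_scaleR_bounded_continuous[OF f, where B = B2])
       (auto intro!: continuous_on_minus continuous_on_compose2[OF G] continuous_intros B2)
  define A where "A = (LINT y|lborel. \<bar>f y\<bar>)"
  have "A \<ge> 0" by (simp add: A_def)
  have unifG: "uniformly_continuous_on UNIV G"
    by (rule uniformly_continuous_on_if_vanishing_outside_cball[OF G zero(2)])
  have unif: "uniformly_continuous_on UNIV (\<lambda>x. blinfun_inner_right (G x))"
    by (rule bounded_linear.uniformly_continuous_on[OF bounded_linear_blinfun_inner_right unifG])
  have d\<rho>: "(\<rho> has_derivative blinfun_apply (blinfun_inner_right (G x))) (at x)" for x
    using \<rho>[of x] by (simp add: blinfun_inner_right.rep_eq)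
  show "(?u has_derivative (\<lambda>h. ?U x \<bullet> h)) (at x)"
    unfolding has_derivative_at_alt
  proof (intro conjI allI impI)
    show "bounded_linear (\<lambda>h. ?U x \<bullet> h)" by (rule bounded_linear_inner_right)
    fix e :: real assume "e > 0"
    then have "e / (A + 1) > 0" using \<open>A \<ge> 0\<close> by simp
    then obtain d where d: "d > 0" "\<And>x h. norm h < d \<Longrightarrow>
        norm (\<rho> (x + h) - \<rho> x - blinfun_apply (blinfun_inner_right (G x)) h) \<le> e / (A + 1) * norm h"
      using uniform_linear_approximation[OF d\<rho> unif] by metis
    have "norm (?u z - ?u x - ?U x \<bullet> (z - x)) \<le> e * norm (z - x)" if "norm (z - x) < d" for z
    proof -
      define h where "h = z - x"
      let ?q = "\<lambda>y. f y * \<rho> (y - z) - f y * \<rho> (y - x) - (f y *\<^sub>R (- G (y - x))) \<bullet> h"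
      have intq: "integrable lborel ?q"
        by (intro Bochner_Integration.integrable_diff int\<rho> integrable_inner_left intG)
      have "?u z - ?u x - ?U x \<bullet> h = (LINT y|lborel. ?q y)"
        by (simp only: Bochner_Integration.integral_diff int\<rho> integrable_inner_left intG
            Bochner_Integration.integrable_diff integral_inner_left)
      also have "norm \<dots> \<le> (LINT y|lborel. (e / (A + 1) * norm h) * \<bar>f y\<bar>)"
      proof (rule Bochner_Integration.integral_norm_bound_integral[OF intq])
        show "integrable lborel (\<lambda>y. (e / (A + 1) * norm h) * \<bar>f y\<bar>)" using f by simp
        fix y
        have "?q y = f y * (\<rho> (y - x + (- h)) - \<rho> (y - x) - G (y - x) \<bullet> (- h))"
          by (simp add: h_def algebra_simps)
        also have "norm \<dots> \<le> \<bar>f y\<bar> * (e / (A + 1) * norm h)"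
          unfolding norm_mult using d(2)[of "- h" "y - x"] that
          by (intro mult_mono) (auto simp: h_def blinfun_inner_right.rep_eq norm_minus_commute[of x z])
        finally show "norm (?q y) \<le> (e / (A + 1) * norm h) * \<bar>f y\<bar>" by (simp add: mult.commute)
      qed
      also have "\<dots> = e * norm h * (A / (A + 1))" by (simp add: A_def)
      also have "\<dots> \<le> e * norm h * 1"
        using \<open>e > 0\<close> \<open>A \<ge> 0\<close> by (intro mult_left_mono) (auto simp: field_simps)
      finally show ?thesis by (simp add: h_def)
    qed
    with d(1) show "\<exists>d>0. \<forall>z. norm (z - x) < d \<longrightarrow> norm (?u z - ?u x - ?U x \<bullet> (z - x)) \<le> e * norm (z - x)"
      by blast
  qed
  show "continuous_on UNIV (\<lambda>x. ?U x)"
    unfolding continuous_on_iff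
  proof (intro ballI allI impI)
    fix x :: 'a and e :: real assume "e > 0"
    then have e: "e / (A + 1) > 0" using \<open>A \<ge> 0\<close> by simp
    then obtain d where d: "d > 0" "\<And>x y. dist y x < d \<Longrightarrow> dist (G y) (G x) < e / (A + 1)"
      using unifG unfolding uniformly_continuous_on_def by (metis UNIV_I)
    have "dist (?U z) (?U x) < e" if "dist z x < d" for z
    proof -
      have "?U z - ?U x = (LINT y|lborel. f y *\<^sub>R (- G (y - z)) - f y *\<^sub>R (- G (y - x)))"
        by (simp only: Bochner_Integration.integral_diff intG)
      also have "norm \<dots> \<le> (LINT y|lborel. (e / (A + 1)) * \<bar>f y\<bar>)"
      proof (rule Bochner_Integration.integral_norm_bound_integral)
        show "integrable lborel (\<lambda>y. (e / (A + 1)) * \<bar>f y\<bar>)" using f by simp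
        fix y
        have "dist (y - x) (y - z) < d" using that by (simp add: dist_norm norm_minus_commute)
        then have "norm (G (y - x) - G (y - z)) \<le> e / (A + 1)"
          using d(2)[of "y - x" "y - z"] by (simp add: dist_norm)
        then have "\<bar>f y\<bar> * norm (G (y - x) - G (y - z)) \<le> \<bar>f y\<bar> * (e / (A + 1))"
          by (intro mult_left_mono) auto
        moreover have "f y *\<^sub>R (- G (y - z)) - f y *\<^sub>R (- G (y - x)) = f y *\<^sub>R (G (y - x) - G (y - z))"
          by (simp add: algebra_simps)
        ultimately show "norm (f y *\<^sub>R (- G (y - z)) - f y *\<^sub>R (- G (y - x))) \<le> (e / (A + 1)) * \<bar>f y\<bar>"
          by (simp add: mult.commute)
      qed (intro Bochner_Integration.integrable_diff intG)
      also have "\<dots> = e * (A / (A + 1))" by (simp add: A_def)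
      also have "\<dots> < e * 1"
        using \<open>e > 0\<close> \<open>A \<ge> 0\<close> by (intro mult_strict_left_mono) (auto simp: field_simps)
      finally show ?thesis by (simp add: dist_norm)
    qed
    with d(1) show "\<exists>d>0. \<forall>z\<in>UNIV. dist z x < d \<longrightarrow> dist (?U z) (?U x) < e" by blast
  qed
qed

section \<open>Splitting the total variation of a bounded measurable function at a level\<close>

text \<open>The competitors for the TV profile, in a normal form: Borel measurable and with the bounds holding
everywhere. The class is stable under truncation and convex combination, and all level
sets of its members at nonnegative heights lie in \<open>\<Omega>\<close>.\<close>

definition layer :: "(real^'n) set \<Rightarrow> (real^'n \<Rightarrow> real) \<Rightarrow> bool" where
  "layer \<Omega> f \<longleftrightarrow> f \<in> borel_measurable borel \<and> (\<forall>x. 0 \<le> f x \<and> f x \<le> indicat_real \<Omega> x)"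

lemma layer_measurable: "layer \<Omega> f \<Longrightarrow> f \<in> borel_measurable borel"
  by (simp add: layer_def)

lemma layer_bounds:
  assumes "layer \<Omega> f"
  shows "0 \<le> f x" "f x \<le> 1" "f x \<le> indicat_real \<Omega> x" "x \<notin> \<Omega> \<Longrightarrow> f x = 0"
proof -
  have "0 \<le> f x \<and> f x \<le> indicat_real \<Omega> x" using assms by (simp add: layer_def)
  then show "0 \<le> f x" "f x \<le> 1" "f x \<le> indicat_real \<Omega> x" "x \<notin> \<Omega> \<Longrightarrow> f x = 0"
    by (auto split: split_indicator_asm)
qed

lemma layerI:
  assumes "f \<in> borel_measurable borel" "\<And>x. 0 \<le> f x" "\<And>x. f x \<le> 1" "\<And>x. x \<notin> \<Omega> \<Longrightarrow> f x = 0"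
  shows "layer \<Omega> f"
  using assms by (auto simp: layer_def indicator_def)

lemma compact_subset_cball:
  fixes \<Omega> :: "'a::euclidean_space set"
  assumes "compact \<Omega>"
  obtains R where "R > 0" "\<And>x. R < norm x \<Longrightarrow> x \<notin> \<Omega>"
proof -
  obtain R where "R > 0" "\<And>x. x \<in> \<Omega> \<Longrightarrow> norm x \<le> R"
    using compact_imp_bounded[OF assms] unfolding bounded_pos by auto
  then show thesis using that[of R] by force
qed

lemma integrable_layer:
  assumes "compact \<Omega>" "layer \<Omega> f"
  shows "integrable lborel f"
proof (rule integrableI_bounded_set[where A = \<Omega> and B = 1])
  show "\<Omega> \<in> sets lborel" using assms(1) by (simp add: borel_compact)
  show "emeasure lborel \<Omega> < \<infinity>" using assms(1) by (rule emeasure_compact_finite)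
qed (use layer_measurable[OF assms(2)] layer_bounds[OF assms(2)] in auto)

text \<open>A measurable function is an almost everywhere limit of continuous functions. Clipping these to
\<open>[0, 1]\<close> and multiplying by a cutoff that is \<open>1\<close> on a ball containing \<open>\<Omega>\<close> preserves the limit and
provides a dominating function.\<close>

lemma L1_approximation_by_continuous:
  fixes f :: "real^'n \<Rightarrow> real"
  assumes \<Omega>: "compact \<Omega>" and f: "layer \<Omega> f" and "e > 0"
  obtains g r where "continuous_on UNIV g" "\<And>x. r < norm x \<Longrightarrow> g x = 0"
    "(LINT x|lborel. \<bar>f x - g x\<bar>) < e"
proof -
  obtain R where R: "R > 0" "\<And>x. R < norm x \<Longrightarrow> x \<notin> \<Omega>"
    using compact_subset_cball[OF \<Omega>] by metis
  have fm[measurable]: "f \<in> borel_measurable borel" using layer_measurable[OF f] .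
  have "f \<in> borel_measurable lebesgue"
    by (rule measurable_completion) simp
  then have "f measurable_on UNIV"
    by (rule lebesgue_measurable_imp_measurable_on_real) simp
  then obtain N g where N: "negligible N" and g: "\<And>n. continuous_on UNIV (g n)"
    "\<And>x. x \<notin> N \<Longrightarrow> (\<lambda>n. g n x) \<longlonglongrightarrow> f x"
    unfolding measurable_on_def by auto
  \<comment> \<open>The second factor is \<open>1\<close> on the ball of radius \<open>R\<close> and \<open>0\<close> outside radius \<open>R + 1\<close>.\<close>
  define k where "k n x = max 0 (min 1 (g n x)) * max 0 (min 1 (R + 1 - norm x))" for n :: nat and x :: "real^'n"
  have k: "continuous_on UNIV (k n)" for n
    unfolding k_def by (intro continuous_intros g)
  have k0: "k n x = 0" if "R + 1 < norm x" for n x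
    using that by (simp add: k_def)
  have k01: "0 \<le> k n x" "k n x \<le> 1" for n x
  proof -
    show "0 \<le> k n x" by (simp add: k_def)
    have "k n x \<le> 1 * 1" unfolding k_def by (rule mult_mono) auto
    then show "k n x \<le> 1" by simp
  qed
  have km[measurable]: "k n \<in> borel_measurable borel" for n
    using k by (rule borel_measurable_continuous_onI)
  have lim: "(\<lambda>n. k n x) \<longlonglongrightarrow> f x" if "x \<notin> N" for x
  proof -
    have "(\<lambda>n. k n x) \<longlonglongrightarrow> max 0 (min 1 (f x)) * max 0 (min 1 (R + 1 - norm x))"
      unfolding k_def by (intro tendsto_intros g(2) that)
    moreover have "max 0 (min 1 (f x)) * max 0 (min 1 (R + 1 - norm x)) = f x"
      using layer_bounds[OF f, of x] R(2)[of x] by (cases "norm x \<le> R") auto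
    ultimately show ?thesis by (simp only:)
  qed
  have "AE x in lborel. x \<notin> N"
    using AE_not_in[of N lebesgue] N by (simp add: negligible_iff_null_sets AE_completion_iff)
  then have lim': "AE x in lborel. (\<lambda>n. \<bar>f x - k n x\<bar>) \<longlonglongrightarrow> 0"
  proof eventually_elim
    case (elim x)
    have "(\<lambda>n. \<bar>f x - k n x\<bar>) \<longlonglongrightarrow> \<bar>f x - f x\<bar>"
      by (intro tendsto_intros lim elim)
    then show ?case by simp
  qed
  have "(\<lambda>n. LINT x|lborel. \<bar>f x - k n x\<bar>) \<longlonglongrightarrow> (LINT x|(lborel::(real^'n) measure). 0)"
  proof (rule integral_dominated_convergence[where w = "indicat_real (cball 0 (R + 1))"])
    show "integrable lborel (indicat_real (cball (0::real^'n) (R + 1)))"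
      using emeasure_lborel_cball_finite[of "0::real^'n" "R + 1"] by simp
    have "\<bar>f x - k n x\<bar> \<le> indicat_real (cball 0 (R + 1)) x" for n x
    proof (cases "norm x \<le> R + 1")
      case True
      then show ?thesis using layer_bounds[OF f, of x] k01[of n x] by (simp add: abs_le_iff)
    next
      case False
      then show ?thesis using layer_bounds(4)[OF f, of x] R(2)[of x] k0[of x n] by simp
    qed
    then show "AE x in lborel. norm \<bar>f x - k n x\<bar> \<le> indicat_real (cball 0 (R + 1)) x" for n
      by simp
  qed (use lim' in simp_all)
  then have "(\<lambda>n. LINT x|lborel. \<bar>f x - k n x\<bar>) \<longlonglongrightarrow> 0" by simp
  then have "\<forall>\<^sub>F n in sequentially. (LINT x|lborel. \<bar>f x - k n x\<bar>) < e"
    using \<open>e > 0\<close> by (rule order_tendstoD(2))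
  then obtain n where n: "(LINT x|lborel. \<bar>f x - k n x\<bar>) < e"
    by (auto simp: eventually_sequentially)
  show thesis by (rule that[OF k k0 n])
qed

text \<open>For a continuous compactly supported \<open>g\<close> this is uniform continuity; approximating \<open>f\<close> by \<open>g\<close> in L1
costs \<open>e/3\<close> once for \<open>f\<close> and once for its translate.\<close>

lemma L1_continuity_of_translation:
  fixes f :: "real^'n \<Rightarrow> real"
  assumes \<Omega>: "compact \<Omega>" and f: "layer \<Omega> f" and "e > 0"
  obtains d where "d > 0" "\<And>y. norm y \<le> d \<Longrightarrow> (LINT x|lborel. \<bar>f (y + x) - f x\<bar>) \<le> e"
proof -
  obtain g r where g: "continuous_on UNIV g" "\<And>x. r < norm x \<Longrightarrow> g x = 0"
    "(LINT x|lborel. \<bar>f x - g x\<bar>) < e / 3"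
    using L1_approximation_by_continuous[OF \<Omega> f, of "e / 3"] \<open>e > 0\<close> by auto
  have intf: "integrable lborel f" by (rule integrable_layer[OF \<Omega> f])
  have intg: "integrable lborel g"
    by (rule integrable_if_continuous_vanishing_outside_cball[OF g(1,2)])
  define V where "V = measure lborel (cball (0::real^'n) (r + 1))"
  have "V \<ge> 0" by (simp add: V_def)
  then have "e / (3 * (V + 1)) > 0" using \<open>e > 0\<close> by simp
  then obtain d where d: "d > 0" "\<And>x y. dist y x < d \<Longrightarrow> dist (g y) (g x) < e / (3 * (V + 1))"
    using uniformly_continuous_on_if_vanishing_outside_cball[OF g(1,2)]
    unfolding uniformly_continuous_on_def by (metis UNIV_I)
  have "(LINT x|lborel. \<bar>f (y + x) - f x\<bar>) \<le> e" if y: "norm y \<le> min 1 d / 2" for y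
  proof -
    have y': "norm y < d" "norm y \<le> 1" using y d(1) by auto
    have intf': "integrable lborel (\<lambda>x. f (y + x))" by (rule integrable_lborel_translate[OF intf])
    have intg': "integrable lborel (\<lambda>x. g (y + x))" by (rule integrable_lborel_translate[OF intg])
    have shift: "(LINT x|lborel. \<bar>f (y + x) - g (y + x)\<bar>) = (LINT x|lborel. \<bar>f x - g x\<bar>)"
      using intf intg by (intro integral_lborel_translate[of "\<lambda>x. \<bar>f x - g x\<bar>"]) auto
    have mid: "(LINT x|lborel. \<bar>g (y + x) - g x\<bar>) \<le> e / 3"
    proof -
      have "\<bar>g (y + x) - g x\<bar> \<le> (e / (3 * (V + 1))) *\<^sub>R indicat_real (cball 0 (r + 1)) x" for x
      proof (cases "norm x \<le> r + 1")
        case True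
        then show ?thesis using d(2)[of "y + x" x] y' by (simp add: dist_norm less_imp_le)
      next
        case False
        then have "r < norm (y + x)" "r < norm x"
          using norm_triangle_ineq2[of x "- y"] y' by (auto simp: add.commute)
        then show ?thesis using g(2) False by simp
      qed
      then have "(LINT x|lborel. \<bar>g (y + x) - g x\<bar>)
          \<le> (LINT x|lborel. (e / (3 * (V + 1))) *\<^sub>R indicat_real (cball (0::real^'n) (r + 1)) x)"
        using intg intg' emeasure_lborel_cball_finite[of "0::real^'n" "r + 1"]
        by (intro Bochner_Integration.integral_mono integrable_scaleR_right) auto
      also have "\<dots> = e * (V / (3 * (V + 1)))" by (simp add: V_def)
      also have "\<dots> \<le> e * (1 / 3)"
        using \<open>e > 0\<close> \<open>V \<ge> 0\<close> by (intro mult_left_mono) (auto simp: field_simps)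
      finally show ?thesis by simp
    qed
    have "(LINT x|lborel. \<bar>f (y + x) - f x\<bar>) \<le> (LINT x|lborel.
        \<bar>f (y + x) - g (y + x)\<bar> + \<bar>g (y + x) - g x\<bar> + \<bar>f x - g x\<bar>)"
      using intf intf' intg intg' by (intro Bochner_Integration.integral_mono) auto
    also have "\<dots> = (LINT x|lborel. \<bar>f (y + x) - g (y + x)\<bar>) + (LINT x|lborel. \<bar>g (y + x) - g x\<bar>)
        + (LINT x|lborel. \<bar>f x - g x\<bar>)"
      using intf intf' intg intg' by simp
    finally show ?thesis using shift mid g(3) by linarith
  qed
  then show thesis using d(1) by (intro that[of "min 1 d / 2"]) auto
qed

text \<open>The approximation is \<open>u(x) = \<integral> \<rho>(y) f(y + x) dy\<close>, an average of translates of \<open>f\<close>. Testing a translate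
of \<open>f\<close> with \<open>\<phi>\<close> is testing \<open>f\<close> with a translate of \<open>\<phi>\<close>, so no translate exceeds the total variation
of \<open>f\<close>, and neither does their average.\<close>

lemma C1_approximation_of_layer:
  fixes f :: "real^'n \<Rightarrow> real"
  assumes \<Omega>: "compact \<Omega>" and f: "layer \<Omega> f" and "e > 0"
  obtains u U where "\<And>x. (u has_derivative (\<lambda>h. U x \<bullet> h)) (at x)" "continuous_on UNIV U"
    "total_variation u \<le> total_variation f"
    "integrable lborel u" "(LINT x|lborel. \<bar>u x - f x\<bar>) \<le> e"
proof -
  obtain R where R: "R > 0" "\<And>x. R < norm x \<Longrightarrow> x \<notin> \<Omega>"
    using compact_subset_cball[OF \<Omega>] by metis
  have fm[measurable]: "f \<in> borel_measurable borel" using layer_measurable[OF f] .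
  have intf: "integrable lborel f" by (rule integrable_layer[OF \<Omega> f])
  obtain d where d: "d > 0" "\<And>y. norm y \<le> d \<Longrightarrow> (LINT x|lborel. \<bar>f (y + x) - f x\<bar>) \<le> e"
    using L1_continuity_of_translation[OF \<Omega> f \<open>e > 0\<close>] by metis
  obtain \<rho> :: "real^'n \<Rightarrow> real" and G where "C1_mollifier d \<rho> G"
    using C1_mollifier_exists[OF d(1)] by blast
  note \<rho> = C1_mollifierD[OF this]
  have cont\<rho>: "continuous_on UNIV \<rho>"
    by (rule continuous_on_UNIV_if_has_derivative[OF \<rho>(1)])
  have \<rho>m[measurable]: "\<rho> \<in> borel_measurable borel"
    using cont\<rho> by (rule borel_measurable_continuous_onI)
  have int\<rho>: "integrable lborel \<rho>"
    by (rule integrable_if_continuous_vanishing_outside_cball[OF cont\<rho> \<rho>(3)])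
  note average = weighted_average_le[OF cont\<rho> \<rho>(3,5,6)]
  define u where "u x = (LINT y|lborel. f y * \<rho> (y - x))" for x
  have u: "u x = (LINT y|lborel. \<rho> y * f (y + x))" for x
  proof -
    have "u x = (LINT y|lborel. (\<lambda>y. f y * \<rho> (y - x)) (x + y))"
      unfolding u_def by (rule integral_lborel_translate[symmetric]) measurable
    then show ?thesis by (simp add: algebra_simps)
  qed
  note C1 = convolution_C1[OF intf \<rho>(1-4)]
  have contu: "continuous_on UNIV u"
    unfolding u_def[abs_def] by (rule continuous_on_UNIV_if_has_derivative[OF C1(1)])
  have int\<rho>f: "integrable lborel (\<lambda>y. \<rho> y * f (y + x))" for x
    using layer_bounds(1,2)[OF f] \<rho>(5)
    by (intro Bochner_Integration.integrable_bound[OF int\<rho>])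
       (auto simp: mult_left_le intro!: AE_I2)
  have zero: "f (y + x) = 0" "f x = 0" if "norm y \<le> d" "R + d < norm x" for x y
  proof -
    have "R < norm (y + x)" "R < norm x"
      using norm_triangle_ineq2[of x "- y"] that d(1) norm_ge_zero[of y] by (auto simp: add.commute)
    then show "f (y + x) = 0" "f x = 0" using R(2) layer_bounds(4)[OF f] by blast+
  qed
  have L1: "(LINT x|lborel. \<bar>u x - f x\<bar>) \<le> e \<and> integrable lborel u"
  proof -
    have "(\<lambda>(x, y). \<bar>f (y + x) - f x\<bar>) \<in> borel_measurable (borel \<Otimes>\<^sub>M borel)"
      by measurable
    moreover have "\<bar>\<bar>f (y + x) - f x\<bar>\<bar> \<le> 1" for x y
      using layer_bounds(1,2)[OF f, of x] layer_bounds(1,2)[OF f, of "y + x"] by simp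
    moreover have "\<bar>f (y + x) - f x\<bar> = 0" if "norm y \<le> d" "R + d < norm x" for x y
      using zero that by simp
    ultimately have A: "integrable lborel (\<lambda>x. LINT y|lborel. \<rho> y * \<bar>f (y + x) - f x\<bar>)"
      "(LINT x|lborel. LINT y|lborel. \<rho> y * \<bar>f (y + x) - f x\<bar>) \<le> e"
      using average[where H = "\<lambda>x y. \<bar>f (y + x) - f x\<bar>" and B = 1 and K = "R + d" and T = e] d(2)
      by auto
    have le: "\<bar>u x - f x\<bar> \<le> (LINT y|lborel. \<rho> y * \<bar>f (y + x) - f x\<bar>)" for x
    proof -
      have "(LINT y|lborel. \<rho> y * f x) = f x" using \<rho>(6) by simp
      then have "u x - f x = (LINT y|lborel. \<rho> y * f (y + x) - \<rho> y * f x)"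
        using int\<rho>f[of x] int\<rho> u[of x] by simp
      also have "\<bar>\<dots>\<bar> \<le> (LINT y|lborel. \<bar>\<rho> y * f (y + x) - \<rho> y * f x\<bar>)"
        by (rule integral_abs_bound)
      also have "\<dots> = (LINT y|lborel. \<rho> y * \<bar>f (y + x) - f x\<bar>)"
        using \<rho>(5) by (intro Bochner_Integration.integral_cong refl) (metis abs_mult abs_of_nonneg right_diff_distrib)
      finally show ?thesis .
    qed
    have um[measurable]: "u \<in> borel_measurable borel" using contu by (rule borel_measurable_continuous_onI)
    have intuf: "integrable lborel (\<lambda>x. u x - f x)"
      by (rule Bochner_Integration.integrable_bound[OF A(1)])
         (use le in \<open>auto intro!: AE_I2 order_trans[OF le abs_ge_self]\<close>)
    have "(LINT x|lborel. \<bar>u x - f x\<bar>) \<le> (LINT x|lborel. LINT y|lborel. \<rho> y * \<bar>f (y + x) - f x\<bar>)"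
      using intuf le A(1) by (intro Bochner_Integration.integral_mono) auto
    moreover have "integrable lborel u"
      using Bochner_Integration.integrable_add[OF intuf intf] by simp
    ultimately show ?thesis using A(2) by simp
  qed
  have TV: "total_variation u \<le> total_variation f"
  proof (cases "total_variation f")
    case (real T)
    have "ereal (LINT x|lborel. u x * divergence \<phi> x) \<le> ereal T" if \<phi>: "unit_field \<phi>" for \<phi>
    proof -
      obtain B where B: "B > 0" "\<And>x. \<bar>divergence \<phi> x\<bar> \<le> B"
        using divergenceE[OF unit_fieldD(1)[OF \<phi>]] by metis
      have [measurable]: "divergence \<phi> \<in> borel_measurable borel"
        using borel_measurable_divergence unit_fieldD(1)[OF \<phi>] .
      have "(LINT x|lborel. LINT y|lborel. \<rho> y * (f (y + x) * divergence \<phi> x)) \<le> T"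
      proof (rule average[where B = B and K = "R + d"])
        show "\<bar>f (y + x) * divergence \<phi> x\<bar> \<le> B" for x y
          using mult_mono[of "\<bar>f (y + x)\<bar>" 1 "\<bar>divergence \<phi> x\<bar>" B] B
            layer_bounds(1,2)[OF f, of "y + x"] by (simp add: abs_mult)
        show "f (y + x) * divergence \<phi> x = 0" if "norm y \<le> d" "R + d < norm x" for x y
          using zero that by simp
        fix y :: "real^'n"
        note tr = C1_compact_support_translate[OF unit_fieldD(1)[OF \<phi>], of y]
        have "unit_field (\<lambda>x. \<phi> (x - y))"
          using tr(1) unit_fieldD(2)[OF \<phi>] by (simp add: unit_field_def)
        then have "(LINT x|lborel. f x * divergence (\<lambda>x. \<phi> (x - y)) x) \<le> T"
          using total_variation_upper[OF fm] real by (metis ereal_less_eq(3))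
        moreover have "(LINT x|lborel. f (y + x) * divergence \<phi> x) = (LINT x|lborel. f x * divergence \<phi> (x - y))"
          using integral_lborel_translate[of "\<lambda>x. f x * divergence \<phi> (x - y)" y] by simp
        ultimately show "(LINT x|lborel. f (y + x) * divergence \<phi> x) \<le> T"
          by (simp add: tr(2))
      qed measurable
      moreover have "(LINT y|lborel. \<rho> y * (f (y + x) * divergence \<phi> x)) = u x * divergence \<phi> x" for x
      proof -
        have "(LINT y|lborel. \<rho> y * (f (y + x) * divergence \<phi> x)) = (LINT y|lborel. (\<rho> y * f (y + x)) * divergence \<phi> x)"
          by (simp add: mult.assoc)
        then show ?thesis by (simp add: u)
      qed
      ultimately show ?thesis by simp
    qed
    then show ?thesis
      unfolding real total_variation_eq_lborel[OF borel_measurable_continuous_onI[OF contu]]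
      by (intro SUP_least) simp
  qed (use total_variation_nonneg[of f] in auto)
  show thesis
    by (rule that[of u, OF C1(1)[folded u_def] C1(2) TV]) (use L1 in auto)
qed

text \<open>This inequality carries the proof: it says that cutting the graph of \<open>f\<close> at height \<open>c\<close> creates no
total variation. For fixed test fields \<open>\<phi>\<close> and \<open>\<psi>\<close> it passes from C1 functions to \<open>f\<close>, since
truncation is a contraction in L1 and divergences are bounded.\<close>

lemma total_variation_truncation:
  fixes f :: "real^'n \<Rightarrow> real"
  assumes \<Omega>: "compact \<Omega>" and f: "layer \<Omega> f" and "c \<ge> 0"
  shows "total_variation (\<lambda>x. min (f x) c) + total_variation (\<lambda>x. max (f x - c) 0) \<le> total_variation f"
proof (cases "total_variation f")
  case (real T)
  have [measurable]: "f \<in> borel_measurable borel" using layer_measurable[OF f] .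
  have intf: "integrable lborel f" by (rule integrable_layer[OF \<Omega> f])
  let ?A = "\<lambda>\<phi>. LINT x|lborel. min (f x) c * divergence \<phi> x"
  let ?B = "\<lambda>\<phi>. LINT x|lborel. max (f x - c) 0 * divergence \<phi> x"
  have main: "?A \<phi> + ?B \<psi> \<le> T" if \<phi>: "unit_field \<phi>" and \<psi>: "unit_field \<psi>" for \<phi> \<psi>
  proof -
    obtain B1 where B1: "B1 > 0" "\<And>x. \<bar>divergence \<phi> x\<bar> \<le> B1" "continuous_on UNIV (divergence \<phi>)"
      using divergenceE[OF unit_fieldD(1)[OF \<phi>]] by metis
    obtain B2 where B2: "B2 > 0" "\<And>x. \<bar>divergence \<psi> x\<bar> \<le> B2" "continuous_on UNIV (divergence \<psi>)"
      using divergenceE[OF unit_fieldD(1)[OF \<psi>]] by metis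
    have "?A \<phi> + ?B \<psi> \<le> T + (B1 + B2) * e" if "e > 0" for e
    proof -
      obtain u U where u: "\<And>x. (u has_derivative (\<lambda>h. U x \<bullet> h)) (at x)" "continuous_on UNIV U"
        "total_variation u \<le> total_variation f"
        "integrable lborel u" "(LINT x|lborel. \<bar>u x - f x\<bar>) \<le> e"
        using C1_approximation_of_layer[OF \<Omega> f \<open>e > 0\<close>] by blast
      have [measurable]: "u \<in> borel_measurable borel" using u(4) by auto
      have perturb: "(LINT x|lborel. v x * divergence \<zeta> x) \<le> (LINT x|lborel. w x * divergence \<zeta> x) + B * e"
        if vw: "integrable lborel v" "integrable lborel w" "\<And>x. \<bar>v x - w x\<bar> \<le> \<bar>u x - f x\<bar>"
          and B: "\<And>x. \<bar>divergence \<zeta> x\<bar> \<le> B" "continuous_on UNIV (divergence \<zeta>)" "B > 0" for v w \<zeta> B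
      proof -
        have iv: "integrable lborel (\<lambda>x. v x * divergence \<zeta> x)"
          using integrable_scaleR_bounded_continuous[OF vw(1) B(2), of B] B(1) by simp
        have iw: "integrable lborel (\<lambda>x. w x * divergence \<zeta> x)"
          using integrable_scaleR_bounded_continuous[OF vw(2) B(2), of B] B(1) by simp
        have "v x * divergence \<zeta> x \<le> w x * divergence \<zeta> x + B * \<bar>u x - f x\<bar>" for x
        proof -
          have "(v x - w x) * divergence \<zeta> x \<le> \<bar>v x - w x\<bar> * \<bar>divergence \<zeta> x\<bar>"
            by (metis abs_ge_self abs_mult)
          also have "\<dots> \<le> \<bar>u x - f x\<bar> * B"
            using vw(3)[of x] B(1)[of x] by (intro mult_mono) auto
          finally show ?thesis by (simp add: algebra_simps)
        qed
        then have "(LINT x|lborel. v x * divergence \<zeta> x) \<le> (LINT x|lborel. w x * divergence \<zeta> x + B * \<bar>u x - f x\<bar>)"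
          using iv iw u(4) intf by (intro Bochner_Integration.integral_mono) auto
        also have "\<dots> = (LINT x|lborel. w x * divergence \<zeta> x) + B * (LINT x|lborel. \<bar>u x - f x\<bar>)"
          using iw u(4) intf by simp
        also have "\<dots> \<le> (LINT x|lborel. w x * divergence \<zeta> x) + B * e"
          using u(5) B(3) by simp
        finally show ?thesis .
      qed
      have int_min: "integrable lborel (\<lambda>x. min (v x) c)" and int_max: "integrable lborel (\<lambda>x. max (v x - c) 0)"
        if "integrable lborel v" for v :: "real^'n \<Rightarrow> real"
        by (rule Bochner_Integration.integrable_bound[OF that]; use that \<open>c \<ge> 0\<close> in \<open>auto intro!: AE_I2\<close>)+
      have "?A \<phi> \<le> (LINT x|lborel. min (u x) c * divergence \<phi> x) + B1 * e"
        by (rule perturb) (auto intro: int_min intf u(4) B1)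
      moreover have "?B \<psi> \<le> (LINT x|lborel. max (u x - c) 0 * divergence \<psi> x) + B2 * e"
        by (rule perturb) (auto intro: int_max intf u(4) B2)
      moreover have "(LINT x|lborel. min (u x) c * divergence \<phi> x) + (LINT x|lborel. max (u x - c) 0 * divergence \<psi> x) \<le> T"
        using order_trans[OF total_variation_ge_truncations_if_C1[OF u(1,2) \<phi> \<psi>] u(3)] real by simp
      ultimately show ?thesis by (simp add: algebra_simps)
    qed
    then show ?thesis by (rule le_if_le_add_mult_epsilon)
  qed
  let ?a = "total_variation (\<lambda>x. min (f x) c)" and ?b = "total_variation (\<lambda>x. max (f x - c) 0)"
  have b: "?b \<le> ereal (T - ?A \<phi>)" if "unit_field \<phi>" for \<phi>
    unfolding total_variation_eq_lborel[of "\<lambda>x. max (f x - c) 0", simplified]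
    using main[OF that] by (intro SUP_least) (auto simp: algebra_simps)
  obtain b where b': "?b = ereal b"
    using b[OF unit_field_zero] total_variation_nonneg[of "\<lambda>x. max (f x - c) 0"] by (cases ?b) auto
  have "?a \<le> ereal (T - b)"
    unfolding total_variation_eq_lborel[of "\<lambda>x. min (f x) c", simplified]
    using b b' by (intro SUP_least) (force simp: algebra_simps)
  then have "?a + ?b \<le> ereal (T - b) + ereal b"
    unfolding b' by (intro add_mono) auto
  then show ?thesis using real by simp
qed (use total_variation_nonneg[of f] in auto)

section \<open>From perimeters of level sets to the total variation\<close>

text \<open>Hypothesis \<open>left\<close> excludes downward jumps, so the set of \<open>s\<close> with \<open>F 0 - e s \<le> F s\<close> contains its
supremum; hypothesis \<open>right\<close> forbids this supremum to lie below \<open>1\<close>.\<close>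

lemma nondecreasing_on_unit_interval_if_right_slopes_nonneg:
  fixes F :: "real \<Rightarrow> real"
  assumes left: "\<And>s t. 0 \<le> s \<Longrightarrow> s \<le> t \<Longrightarrow> t \<le> 1 \<Longrightarrow> F s - L * (t - s) \<le> F t"
    and right: "\<And>s e. 0 \<le> s \<Longrightarrow> s < 1 \<Longrightarrow> e > 0 \<Longrightarrow> \<forall>\<^sub>F t in at_right s. F s - e * (t - s) \<le> F t"
  shows "F 0 \<le> F 1"
proof (rule le_if_le_add_mult_epsilon[where C = 1])
  fix e :: real assume "e > 0"
  define S where "S = {s \<in> {0..1}. F 0 - e * s \<le> F s}"
  define z where "z = Sup S"
  have S0: "0 \<in> S" and bdd: "bdd_above S" by (auto simp: S_def intro!: bdd_aboveI[of _ 1])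
  have z01: "0 \<le> z" "z \<le> 1"
  proof -
    show "0 \<le> z" unfolding z_def by (rule cSup_upper[OF S0 bdd])
    have "S \<noteq> {}" using S0 by blast
    then show "z \<le> 1" unfolding z_def by (rule cSup_least) (simp add: S_def)
  qed
  have "F 0 - e * z \<le> F z"
  proof (rule le_if_le_add_mult_epsilon[where C = "\<bar>L\<bar>"])
    fix \<eta> :: real assume "\<eta> > 0"
    then have "z - \<eta> < Sup S" by (simp add: z_def)
    then obtain s where s: "s \<in> S" "z - \<eta> < s" using S0 less_cSup_iff[of S] bdd by auto
    have "s \<le> z" unfolding z_def using s(1) bdd by (rule cSup_upper)
    then have "F s - L * (z - s) \<le> F z" using s(1) z01 by (intro left) (auto simp: S_def)
    moreover have "L * (z - s) \<le> \<bar>L\<bar> * \<eta>"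
    proof -
      have "L * (z - s) \<le> \<bar>L\<bar> * (z - s)" using \<open>s \<le> z\<close> by (intro mult_right_mono) auto
      also have "\<dots> \<le> \<bar>L\<bar> * \<eta>" using s(2) by (intro mult_left_mono) auto
      finally show ?thesis .
    qed
    moreover have "e * s \<le> e * z" using \<open>s \<le> z\<close> \<open>e > 0\<close> by simp
    moreover have "F 0 - e * s \<le> F s" using s(1) by (simp add: S_def)
    ultimately show "F 0 - e * z \<le> F z + \<bar>L\<bar> * \<eta>" by linarith
  qed
  have "z = 1"
  proof (rule ccontr)
    assume "z \<noteq> 1"
    then have "z < 1" using z01 by simp
    have "\<forall>\<^sub>F t in at_right z. F z - e * (t - z) \<le> F t \<and> t < 1 \<and> z < t"
      using right[OF z01(1) \<open>z < 1\<close> \<open>e > 0\<close>] eventually_at_right_less[of z]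
        order_tendstoD(2)[OF tendsto_ident_at \<open>z < 1\<close>, of "{z<..}"]
      by eventually_elim simp
    then obtain t where t: "F z - e * (t - z) \<le> F t" "t < 1" "z < t"
      using eventually_happens'[OF trivial_limit_at_right_real] by blast
    then have "t \<in> S" using \<open>F 0 - e * z \<le> F z\<close> z01 by (auto simp: S_def algebra_simps)
    then have "t \<le> z" unfolding z_def using bdd by (rule cSup_upper)
    with t show False by simp
  qed
  then show "F 0 \<le> F 1 + 1 * e" using \<open>F 0 - e * z \<le> F z\<close> by simp
qed

lemma total_variation_zero: "total_variation (\<lambda>_::real^'n. 0) = 0"
proof -
  have "{\<phi>::real^'n \<Rightarrow> real^'n. unit_field \<phi>} \<noteq> {}" using unit_field_zero by blast
  then show ?thesis by (simp add: total_variation_eq_lborel zero_ereal_def)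
qed

lemma layer_min: "layer \<Omega> f \<Longrightarrow> 0 \<le> s \<Longrightarrow> layer \<Omega> (\<lambda>x. min (f x) s)"
  using layer_measurable[of \<Omega> f] layer_bounds[of \<Omega> f] by (intro layerI) (auto simp: min.coboundedI1)

lemma integrable_indicator_compact:
  fixes \<Omega> :: "'a::euclidean_space set"
  assumes "compact \<Omega>"
  shows "integrable lborel (\<lambda>x. c *\<^sub>R indicat_real \<Omega> x)"
proof -
  have "integrable lborel (indicat_real \<Omega>)"
    using assms emeasure_compact_finite[OF assms] by (intro integrable_real_indicator) (simp_all add: borel_compact)
  then show ?thesis by simp
qed

text \<open>The slab of \<open>f\<close> between the heights \<open>s\<close> and \<open>t\<close>, divided by its thickness, tends pointwise to the
indicator of \<open>{f > s}\<close> as \<open>t\<close> decreases to \<open>s\<close>. With the weight \<open>w = div \<phi> - a\<close> the integrals compare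
perimeter and volume at the same time.\<close>

lemma scaled_slab_tendsto_level_set:
  fixes f :: "real^'n \<Rightarrow> real" and w :: "real^'n \<Rightarrow> real"
  assumes \<Omega>: "compact \<Omega>" and f: "layer \<Omega> f" and "0 \<le> s"
    and w: "w \<in> borel_measurable borel" and B: "\<And>x. \<bar>w x\<bar> \<le> B"
  shows "((\<lambda>t. (LINT x|lborel. max (min (f x) t - s) 0 / (t - s) * w x))
      \<longlongrightarrow> (LINT x|lborel. indicat_real {x. s < f x} x * w x)) (at_right s)"
proof (rule tendsto_at_right_sequentially[where b = "s + 1"])
  fix S :: "nat \<Rightarrow> real"
  assume S: "\<And>n. s < S n" "S \<longlonglongrightarrow> s"
  have [measurable]: "f \<in> borel_measurable borel" using layer_measurable[OF f] .
  note w[measurable]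
  show "(\<lambda>n. LINT x|lborel. max (min (f x) (S n) - s) 0 / (S n - s) * w x)
      \<longlonglongrightarrow> (LINT x|lborel. indicat_real {x. s < f x} x * w x)"
  proof (rule integral_dominated_convergence[where w = "\<lambda>x. B *\<^sub>R indicat_real \<Omega> x"])
    show "integrable lborel (\<lambda>x. B *\<^sub>R indicat_real \<Omega> x)"
      by (rule integrable_indicator_compact[OF \<Omega>])
    have "(\<lambda>n. max (min (f x) (S n) - s) 0 / (S n - s) * w x) \<longlonglongrightarrow> indicat_real {x. s < f x} x * w x" for x
    proof (rule tendsto_eventually)
      show "\<forall>\<^sub>F n in sequentially. max (min (f x) (S n) - s) 0 / (S n - s) * w x
          = indicat_real {x. s < f x} x * w x"
      proof (cases "s < f x")
        case True
        from order_tendstoD(2)[OF S(2) this] show ?thesis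
        proof eventually_elim
          case (elim n)
          then show ?case using S(1)[of n] True by (simp add: min_def max_def)
        qed
      qed simp
    qed
    then show "AE x in lborel. (\<lambda>n. max (min (f x) (S n) - s) 0 / (S n - s) * w x)
        \<longlonglongrightarrow> indicat_real {x. s < f x} x * w x" by simp
    have "\<bar>max (min (f x) (S n) - s) 0 / (S n - s) * w x\<bar> \<le> B * indicat_real \<Omega> x" for n x
    proof (cases "x \<in> \<Omega>")
      case True
      have "\<bar>max (min (f x) (S n) - s) 0 / (S n - s)\<bar> \<le> 1" using S(1)[of n] by simp
      then have "\<bar>max (min (f x) (S n) - s) 0 / (S n - s) * w x\<bar> \<le> 1 * B"
        unfolding abs_mult using B[of x] by (intro mult_mono) auto
      then show ?thesis using True by simp
    next
      case False
      then show ?thesis using layer_bounds(4)[OF f, of x] \<open>0 \<le> s\<close> S(1)[of n] by simp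
    qed
    then show "AE x in lborel. norm (max (min (f x) (S n) - s) 0 / (S n - s) * w x)
        \<le> B *\<^sub>R indicat_real \<Omega> x" for n by simp
  qed simp_all
qed simp

text \<open>An affine lower bound for perimeters in terms of volumes extends from sets to functions. This is
the part of the coarea formula and Jensen's inequality that the envelope needs. Consider
\<open>F(s) = TV(min f s) - a \<integral> min f s - b s\<close>. By \<open>total_variation_truncation\<close> the increment \<open>F t - F s\<close> is at least
\<open>TV(q) - a \<integral> q - b (t - s)\<close> for the slab \<open>q\<close> between \<open>s\<close> and \<open>t\<close>. Divided by \<open>t - s\<close>, the limit
inferior of this for \<open>t\<close> decreasing to \<open>s\<close> is at least the perimeter of \<open>{f > s}\<close> minus \<open>a\<close> times its
volume minus \<open>b\<close>, which is nonnegative. So \<open>F 0 \<le> F 1\<close>, which is the claim.\<close>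

lemma total_variation_ge_affine:
  fixes f :: "real^'n \<Rightarrow> real"
  assumes \<Omega>: "compact \<Omega>" and f: "layer \<Omega> f"
    and per: "\<And>E. E \<subseteq> \<Omega> \<Longrightarrow> E \<in> sets borel \<Longrightarrow> ereal (a * measure lborel E + b) \<le> perimeter E"
  shows "ereal (a * (LINT x|lborel. f x) + b) \<le> total_variation f"
proof (cases "total_variation f")
  case (real T)
  have fm[measurable]: "f \<in> borel_measurable borel" using layer_measurable[OF f] .
  define V where "V = measure lborel \<Omega>"
  define q where "q s t x = max (min (f x) t - s) 0" for s t x
  define m where "m s = total_variation (\<lambda>x. min (f x) s)" for s
  define F where "F s = real_of_ereal (m s) - a * (LINT x|lborel. min (f x) s) - b * s" for s
  have qm[measurable]: "q s t \<in> borel_measurable borel" for s t unfolding q_def by measurable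
  have intmin: "integrable lborel (\<lambda>x. min (f x) s)" if "0 \<le> s" for s
    by (rule integrable_layer[OF \<Omega> layer_min[OF f that]])
  have int\<Omega>: "integrable lborel (\<lambda>x. c *\<^sub>R indicat_real \<Omega> x)" for c
    by (rule integrable_indicator_compact[OF \<Omega>])
  have q_bounds: "0 \<le> q s t x" "q s t x \<le> (t - s) *\<^sub>R indicat_real \<Omega> x" if "0 \<le> s" "s \<le> t" for s t x
    using that layer_bounds(4)[OF f, of x] by (cases "x \<in> \<Omega>"; auto simp: q_def)+
  have intq: "integrable lborel (q s t)" if "0 \<le> s" "s \<le> t" for s t
    by (rule Bochner_Integration.integrable_bound[OF int\<Omega>[of "t - s"]])
       (use q_bounds[OF that] order_trans[OF q_bounds(2)[OF that] abs_ge_self] in \<open>auto intro!: AE_I2\<close>)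
  have m_fin: "m s = ereal (real_of_ereal (m s))" if "0 \<le> s" for s
  proof -
    have "m s + 0 \<le> m s + total_variation (\<lambda>x. max (f x - s) 0)"
      by (intro add_left_mono total_variation_nonneg)
    also have "\<dots> \<le> ereal T"
      using total_variation_truncation[OF \<Omega> f that] real by (simp add: m_def)
    finally show ?thesis
      using total_variation_nonneg[of "\<lambda>x. min (f x) s"] by (cases "m s") (auto simp: m_def)
  qed
  have step: "F s + c - a * (LINT x|lborel. q s t x) - b * (t - s) \<le> F t"
    if "0 \<le> s" "s \<le> t" "ereal c \<le> total_variation (q s t)" for s t c
  proof -
    have "m s + total_variation (q s t) \<le> m t"
    proof -
      have "(\<lambda>x. min (min (f x) t) s) = (\<lambda>x. min (f x) s)"
        using that by (auto simp: min_def fun_eq_iff)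
      then show ?thesis
        using total_variation_truncation[OF \<Omega> layer_min[OF f, of t], of s] that
        by (simp add: m_def q_def[abs_def])
    qed
    then have "m s + ereal c \<le> m t" using that(3) by (meson add_left_mono order_trans)
    then have "ereal (real_of_ereal (m s) + c) \<le> ereal (real_of_ereal (m t))"
      using m_fin[of s] m_fin[of t] that by (metis order_trans plus_ereal.simps(1))
    then have "real_of_ereal (m s) + c \<le> real_of_ereal (m t)" by simp
    moreover have "(LINT x|lborel. min (f x) t) = (LINT x|lborel. min (f x) s) + (LINT x|lborel. q s t x)"
    proof -
      have "(LINT x|lborel. min (f x) t) = (LINT x|lborel. min (f x) s + q s t x)"
        using that by (intro Bochner_Integration.integral_cong) (auto simp: q_def min_def max_def)
      then show ?thesis using intmin[of s] intq[of s t] that by simp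
    qed
    ultimately show ?thesis unfolding F_def by (simp add: algebra_simps)
  qed
  have "F 0 \<le> F 1"
  proof (rule nondecreasing_on_unit_interval_if_right_slopes_nonneg[where L = "\<bar>a\<bar> * V + \<bar>b\<bar>"])
    fix s t :: real assume st: "0 \<le> s" "s \<le> t" "t \<le> 1"
    have "(LINT x|lborel. q s t x) \<le> (LINT x|lborel. (t - s) *\<^sub>R indicat_real \<Omega> x)"
      using q_bounds[OF st(1,2)] intq[OF st(1,2)] int\<Omega> by (intro Bochner_Integration.integral_mono) auto
    then have q1: "(LINT x|lborel. q s t x) \<le> (t - s) * V" by (simp add: V_def)
    have q0: "0 \<le> (LINT x|lborel. q s t x)" using q_bounds(1)[OF st(1,2)] by simp
    have "\<bar>a * (LINT x|lborel. q s t x)\<bar> \<le> \<bar>a\<bar> * ((t - s) * V)"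
      unfolding abs_mult using q0 q1 by (intro mult_left_mono) auto
    then have "a * (LINT x|lborel. q s t x) \<le> \<bar>a\<bar> * ((t - s) * V)" by linarith
    moreover have "b * (t - s) \<le> \<bar>b\<bar> * (t - s)" using st(2) by (intro mult_right_mono) auto
    moreover have "F s + 0 - a * (LINT x|lborel. q s t x) - b * (t - s) \<le> F t"
      by (rule step[OF st(1,2)]) (use total_variation_nonneg[of "q s t"] in \<open>simp add: zero_ereal_def\<close>)
    ultimately show "F s - (\<bar>a\<bar> * V + \<bar>b\<bar>) * (t - s) \<le> F t"
      by (simp add: algebra_simps)
  next
    fix s e :: real assume s: "0 \<le> s" "s < 1" "e > 0"
    let ?E = "{x. s < f x}"
    have E: "?E \<subseteq> \<Omega>" using layer_bounds(4)[OF f] s(1) by force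
    have Em[measurable]: "?E \<in> sets borel" by measurable
    have "ereal (a * measure lborel ?E + b - e) < ereal (a * measure lborel ?E + b)" using s(3) by simp
    also have "\<dots> \<le> perimeter ?E" by (rule per[OF E Em])
    also have "\<dots> = (SUP \<phi>\<in>{\<phi>. unit_field \<phi>}. ereal (LINT x|lborel. indicat_real ?E x * divergence \<phi> x))"
      unfolding perimeter_def by (rule total_variation_eq_lborel) measurable
    \<comment> \<open>A test field that nearly attains the perimeter of the level set; it then tests all thin slabs above \<open>s\<close>.\<close>
    finally obtain \<phi> where \<phi>: "unit_field \<phi>"
      "a * measure lborel ?E + b - e < (LINT x|lborel. indicat_real ?E x * divergence \<phi> x)"
      by (auto simp: less_SUP_iff)
    obtain B where B: "B > 0" "continuous_on UNIV (divergence \<phi>)" "\<And>x. \<bar>divergence \<phi> x\<bar> \<le> B"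
      using divergenceE[OF unit_fieldD(1)[OF \<phi>(1)]] by metis
    have [measurable]: "divergence \<phi> \<in> borel_measurable borel"
      using borel_measurable_divergence unit_fieldD(1)[OF \<phi>(1)] .
    have int_div: "integrable lborel (\<lambda>x. v x * divergence \<phi> x)" if "integrable lborel v" for v
      using integrable_scaleR_bounded_continuous[OF that B(2), of B] B(3) by simp
    have intE: "integrable lborel (indicat_real ?E)"
      by (rule Bochner_Integration.integrable_bound[OF int\<Omega>[of 1]])
         (use E in \<open>auto intro!: AE_I2 simp: indicator_def\<close>)
    have "((\<lambda>t. (LINT x|lborel. max (min (f x) t - s) 0 / (t - s) * (divergence \<phi> x - a)))
        \<longlongrightarrow> (LINT x|lborel. indicat_real ?E x * (divergence \<phi> x - a))) (at_right s)"
    proof (rule scaled_slab_tendsto_level_set[OF \<Omega> f s(1)])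
      show "\<bar>divergence \<phi> x - a\<bar> \<le> B + \<bar>a\<bar>" for x using B(3)[of x] by linarith
    qed measurable
    moreover have "b - e < (LINT x|lborel. indicat_real ?E x * (divergence \<phi> x - a))"
    proof -
      have "(LINT x|lborel. indicat_real ?E x * (divergence \<phi> x - a))
          = (LINT x|lborel. indicat_real ?E x * divergence \<phi> x - a * indicat_real ?E x)"
        by (simp add: algebra_simps)
      also have "\<dots> = (LINT x|lborel. indicat_real ?E x * divergence \<phi> x) - a * measure lborel ?E"
        using int_div[OF intE] intE by simp
      finally show ?thesis using \<phi>(2) by linarith
    qed
    ultimately have "\<forall>\<^sub>F t in at_right s. b - e < (LINT x|lborel. max (min (f x) t - s) 0 / (t - s) * (divergence \<phi> x - a))"
      by (rule order_tendstoD(1))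
    then show "\<forall>\<^sub>F t in at_right s. F s - e * (t - s) \<le> F t"
      using eventually_at_right_less[of s]
    proof eventually_elim
      case (elim t)
      let ?I = "LINT x|lborel. q s t x" and ?D = "LINT x|lborel. q s t x * divergence \<phi> x"
      have cancel: "(t - s) * (y / (t - s) * z) = y * z" for y z
        using elim(2) by simp
      have iq: "integrable lborel (q s t)" by (rule intq) (use s elim in auto)
      have "(t - s) * (LINT x|lborel. max (min (f x) t - s) 0 / (t - s) * (divergence \<phi> x - a))
          = (LINT x|lborel. (t - s) * (max (min (f x) t - s) 0 / (t - s) * (divergence \<phi> x - a)))"
        by simp
      also have "\<dots> = (LINT x|lborel. q s t x * divergence \<phi> x - a * q s t x)"
        unfolding cancel by (intro Bochner_Integration.integral_cong refl) (simp add: q_def algebra_simps)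
      also have "\<dots> = ?D - a * ?I"
        using int_div[OF iq] iq by simp
      finally have "(t - s) * (b - e) \<le> ?D - a * ?I"
        using mult_left_mono[OF less_imp_le[OF elim(1)], of "t - s"] elim(2) by simp
      moreover have "F s + ?D - a * ?I - b * (t - s) \<le> F t"
        by (rule step) (use s elim total_variation_upper[OF qm \<phi>(1)] in auto)
      ultimately show ?case by (simp add: algebra_simps)
    qed
  qed
  moreover have "F 0 = 0"
  proof -
    have "(\<lambda>x. min (f x) 0) = (\<lambda>_. 0)" using layer_bounds(1)[OF f] by (simp add: fun_eq_iff min_def antisym)
    then show ?thesis by (simp add: F_def m_def total_variation_zero)
  qed
  moreover have "F 1 = T - a * (LINT x|lborel. f x) - b"
  proof -
    have "(\<lambda>x. min (f x) 1) = f" using layer_bounds(2)[OF f] by (simp add: fun_eq_iff)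
    then show ?thesis by (simp add: F_def m_def real)
  qed
  ultimately show ?thesis using real by simp
qed (use total_variation_nonneg[of f] in auto)

section \<open>The convex envelope\<close>

lemma total_variation_cong_AE:
  fixes f g :: "real^'n \<Rightarrow> real"
  assumes [measurable]: "f \<in> borel_measurable lebesgue" "g \<in> borel_measurable lebesgue"
    and eq: "AE x in lebesgue. f x = g x"
  shows "total_variation f = total_variation g"
  unfolding total_variation_def
proof (rule SUP_cong[OF refl])
  fix \<phi> :: "real^'n \<Rightarrow> real^'n"
  assume "\<phi> \<in> {\<phi>. C1_compact_support \<phi> \<and> (\<forall>x. norm (\<phi> x) \<le> 1)}"
  then have [measurable]: "divergence \<phi> \<in> borel_measurable lebesgue"
    by (auto intro!: measurable_completion borel_measurable_divergence)
  have "(LINT x|lebesgue. f x * divergence \<phi> x) = (LINT x|lebesgue. g x * divergence \<phi> x)"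
    using eq by (intro integral_cong_AE) auto
  then show "ereal (LINT x|lebesgue. f x * divergence \<phi> x) = ereal (LINT x|lebesgue. g x * divergence \<phi> x)"
    by simp
qed

text \<open>A Lebesgue measurable function is Borel measurable after a change on a null set; clipping between
\<open>0\<close> and \<open>indicat_real \<Omega>\<close> makes the bounds hold everywhere and changes nothing else.\<close>

lemma layer_representative:
  fixes f :: "real^'n \<Rightarrow> real"
  assumes \<Omega>: "compact \<Omega>" and f: "integrable lebesgue f"
    "AE x in lebesgue. 0 \<le> f x \<and> f x \<le> indicat_real \<Omega> x"
  obtains h where "layer \<Omega> h" "(LINT x|lborel. h x) = (LINT x|lebesgue. f x)"
    "total_variation h = total_variation f"
proof -
  have fm: "f \<in> borel_measurable lebesgue" using f(1) by auto
  obtain g where g[measurable]: "g \<in> borel_measurable lborel" "AE x in lborel. f x = g x"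
    using completion_ex_borel_measurable_real[OF fm] by blast
  have [measurable]: "\<Omega> \<in> sets borel" using \<Omega> by (rule borel_compact)
  define h where "h x = max 0 (min (g x) (indicat_real \<Omega> x))" for x
  have hm[measurable]: "h \<in> borel_measurable borel"
    using g(1) unfolding h_def by measurable
  have h: "layer \<Omega> h"
    using hm by (rule layerI) (auto simp: h_def indicator_def)
  have "AE x in lebesgue. f x = g x"
    using g(2) by (rule AE_completion)
  with f(2) have eq: "AE x in lebesgue. h x = f x"
    by eventually_elim (auto simp: h_def)
  have hm': "h \<in> borel_measurable lebesgue" by (rule measurable_completion) simp
  show thesis
  proof (rule that[OF h])
    have "(LINT x|lborel. h x) = (LINT x|lebesgue. h x)"
      by (subst integral_completion) simp_all
    also have "\<dots> = (LINT x|lebesgue. f x)"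
      using eq hm' fm by (intro integral_cong_AE) auto
    finally show "(LINT x|lborel. h x) = (LINT x|lebesgue. f x)" .
    show "total_variation h = total_variation f"
      by (rule total_variation_cong_AE[OF hm' fm eq])
  qed
qed

lemma TV_profile_eq_layers:
  fixes \<Omega> :: "(real^'n) set"
  assumes \<Omega>: "compact \<Omega>"
  shows "TV_profile \<Omega> t = (INF f\<in>{f. layer \<Omega> f \<and> (LINT x|lborel. f x) = t}. total_variation f)"
proof (rule antisym)
  show "TV_profile \<Omega> t \<le> (INF f\<in>{f. layer \<Omega> f \<and> (LINT x|lborel. f x) = t}. total_variation f)"
    unfolding TV_profile_def
  proof (intro INF_superset_mono subsetI CollectI conjI order_refl)
    fix f assume "f \<in> {f. layer \<Omega> f \<and> (LINT x|lborel. f x) = t}"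
    then have f: "layer \<Omega> f" "(LINT x|lborel. f x) = t" by auto
    have [measurable]: "f \<in> borel_measurable borel" using layer_measurable[OF f(1)] .
    show "integrable lebesgue f"
      using integrable_layer[OF \<Omega> f(1)] by (subst integrable_completion) simp_all
    show "(LINT x|lebesgue. f x) = t"
      using f(2) by (subst integral_completion) simp_all
    show "AE x in lebesgue. 0 \<le> f x \<and> f x \<le> indicat_real \<Omega> x"
      using layer_bounds[OF f(1)] by simp
  qed
  show "(INF f\<in>{f. layer \<Omega> f \<and> (LINT x|lborel. f x) = t}. total_variation f) \<le> TV_profile \<Omega> t"
    unfolding TV_profile_def
  proof (rule INF_mono)
    fix f :: "real^'n \<Rightarrow> real"
    assume "f \<in> {f. integrable lebesgue f \<and> (LINT x|lebesgue. f x) = t \<and>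
        (AE x in lebesgue. 0 \<le> f x \<and> f x \<le> indicat_real \<Omega> x)}"
    then obtain h where "layer \<Omega> h" "(LINT x|lborel. h x) = t" "total_variation h = total_variation f"
      using layer_representative[OF \<Omega>, of f] by auto
    then show "\<exists>h\<in>{f. layer \<Omega> f \<and> (LINT x|lborel. f x) = t}. total_variation h \<le> total_variation f"
      by (intro bexI[of _ h]) auto
  qed
qed

lemma layer_convex_combination:
  assumes "layer \<Omega> f" "layer \<Omega> g" "0 \<le> u" "0 \<le> v" "u + v = (1::real)"
  shows "layer \<Omega> (\<lambda>x. u * f x + v * g x)"
proof (rule layerI)
  show "(\<lambda>x. u * f x + v * g x) \<in> borel_measurable borel"
    using layer_measurable[OF assms(1)] layer_measurable[OF assms(2)] by measurable
  show "0 \<le> u * f x + v * g x" for x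
    using layer_bounds(1)[OF assms(1), of x] layer_bounds(1)[OF assms(2), of x] assms(3,4) by simp
  show "u * f x + v * g x \<le> 1" for x
    using layer_bounds(2)[OF assms(1), of x] layer_bounds(2)[OF assms(2), of x] assms(3-5)
    by (intro convex_bound_le)
qed (use layer_bounds(4)[OF assms(1)] layer_bounds(4)[OF assms(2)] in auto)

lemma total_variation_convex_combination:
  fixes f g :: "real^'n \<Rightarrow> real"
  assumes \<Omega>: "compact \<Omega>" and f: "layer \<Omega> f" and g: "layer \<Omega> g" and uv: "0 \<le> u" "0 \<le> v"
  shows "total_variation (\<lambda>x. u * f x + v * g x) \<le> ereal u * total_variation f + ereal v * total_variation g"
proof -
  have [measurable]: "f \<in> borel_measurable borel" "g \<in> borel_measurable borel"
    using layer_measurable[OF f] layer_measurable[OF g] .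
  have "ereal (LINT x|lborel. (u * f x + v * g x) * divergence \<phi> x)
      \<le> ereal u * total_variation f + ereal v * total_variation g" if \<phi>: "unit_field \<phi>" for \<phi>
  proof -
    obtain B where B: "continuous_on UNIV (divergence \<phi>)" "\<And>x. \<bar>divergence \<phi> x\<bar> \<le> B"
      using divergenceE[OF unit_fieldD(1)[OF \<phi>]] by metis
    have int: "integrable lborel (\<lambda>x. w x * divergence \<phi> x)" if "integrable lborel w" for w
      using integrable_scaleR_bounded_continuous[OF that B(1), of B] B(2) by simp
    have "(LINT x|lborel. (u * f x + v * g x) * divergence \<phi> x)
        = (LINT x|lborel. u * (f x * divergence \<phi> x) + v * (g x * divergence \<phi> x))"
      by (simp add: algebra_simps)
    also have "\<dots> = u * (LINT x|lborel. f x * divergence \<phi> x) + v * (LINT x|lborel. g x * divergence \<phi> x)"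
      using int[OF integrable_layer[OF \<Omega> f]] int[OF integrable_layer[OF \<Omega> g]] by simp
    also have "ereal \<dots> = ereal u * ereal (LINT x|lborel. f x * divergence \<phi> x)
        + ereal v * ereal (LINT x|lborel. g x * divergence \<phi> x)" by simp
    also have "\<dots> \<le> ereal u * total_variation f + ereal v * total_variation g"
      using uv \<phi> by (intro add_mono ereal_mult_left_mono total_variation_upper) auto
    finally show ?thesis .
  qed
  then show ?thesis
    by (subst total_variation_eq_lborel) (auto intro!: SUP_least)
qed

lemma TV_profile_nonneg: "0 \<le> TV_profile \<Omega> t"
  unfolding TV_profile_def by (intro INF_greatest total_variation_nonneg)

text \<open>Convex combinations of nearly optimal competitors for \<open>x\<close> and \<open>y\<close> compete for \<open>u x + v y\<close>.\<close>

lemma TV_profile_convex: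
  fixes \<Omega> :: "(real^'n) set"
  assumes \<Omega>: "compact \<Omega>"
  shows "ereal_convex_on {0..measure lebesgue \<Omega>} (TV_profile \<Omega>)"
  unfolding ereal_convex_on_def
proof (intro conjI ballI allI impI)
  show "convex {0..measure lebesgue \<Omega>}" by simp
  show "TV_profile \<Omega> x \<noteq> - \<infinity>" for x
    using TV_profile_nonneg[of \<Omega> x] by auto
  fix x y u v :: real
  assume uv: "0 \<le> u" "0 \<le> v" "u + v = 1"
  show "TV_profile \<Omega> (u * x + v * y) \<le> ereal u * TV_profile \<Omega> x + ereal v * TV_profile \<Omega> y"
  proof (cases "u = 0 \<or> v = 0")
    case True
    then show ?thesis using uv by (auto simp: zero_ereal_def[symmetric] one_ereal_def[symmetric])
  next
    case False
    then have pos: "0 < u" "0 < v" using uv by auto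
    show ?thesis
    proof (cases "TV_profile \<Omega> x = \<infinity> \<or> TV_profile \<Omega> y = \<infinity>")
      case True
      then have "ereal u * TV_profile \<Omega> x + ereal v * TV_profile \<Omega> y = \<infinity>"
        using pos TV_profile_nonneg[of \<Omega> x] TV_profile_nonneg[of \<Omega> y] by auto
      then show ?thesis by (simp only: ereal_less_eq(1))
    next
      case False
      then obtain a b where ab: "TV_profile \<Omega> x = ereal a" "TV_profile \<Omega> y = ereal b"
        using TV_profile_nonneg[of \<Omega> x] TV_profile_nonneg[of \<Omega> y]
        by (cases "TV_profile \<Omega> x"; cases "TV_profile \<Omega> y") auto
      have "TV_profile \<Omega> (u * x + v * y) \<le> ereal (u * a + v * b) + ereal e" if "e > 0" for e
      proof -
        have "TV_profile \<Omega> x < ereal (a + e)" "TV_profile \<Omega> y < ereal (b + e)"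
          using ab \<open>e > 0\<close> by auto
        then obtain f g where f: "layer \<Omega> f" "(LINT x|lborel. f x) = x" "total_variation f < ereal (a + e)"
          and g: "layer \<Omega> g" "(LINT x|lborel. g x) = y" "total_variation g < ereal (b + e)"
          unfolding TV_profile_eq_layers[OF \<Omega>] by (auto simp: INF_less_iff)
        have "(LINT x|lborel. u * f x + v * g x) = u * x + v * y"
          using f(2) g(2) integrable_layer[OF \<Omega> f(1)] integrable_layer[OF \<Omega> g(1)] by simp
        then have "TV_profile \<Omega> (u * x + v * y) \<le> total_variation (\<lambda>x. u * f x + v * g x)"
          unfolding TV_profile_eq_layers[OF \<Omega>] using layer_convex_combination[OF f(1) g(1) uv]
          by (intro INF_lower) simp
        also have "\<dots> \<le> ereal u * total_variation f + ereal v * total_variation g"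
          by (rule total_variation_convex_combination[OF \<Omega> f(1) g(1) uv(1,2)])
        also have "\<dots> \<le> ereal u * ereal (a + e) + ereal v * ereal (b + e)"
          using uv f(3) g(3) by (intro add_mono ereal_mult_left_mono) (auto intro: less_imp_le)
        also have "\<dots> = ereal (u * a + v * b + (u + v) * e)"
          by (simp add: algebra_simps)
        also have "\<dots> = ereal (u * a + v * b) + ereal e" using uv(3) by simp
        finally show ?thesis .
      qed
      then have "TV_profile \<Omega> (u * x + v * y) \<le> ereal (u * a + v * b)"
        by (rule ereal_le_epsilon2)
      then show ?thesis unfolding ab by simp
    qed
  qed
qed

lemma TV_profile_le_isoperimetric_profile: "TV_profile \<Omega> t \<le> isoperimetric_profile \<Omega> t"
  unfolding isoperimetric_profile_def
proof (rule INF_greatest)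
  fix \<Sigma> assume "\<Sigma> \<in> {\<Sigma>. \<Sigma> \<subseteq> \<Omega> \<and> \<Sigma> \<in> lmeasurable \<and> measure lebesgue \<Sigma> = t}"
  then have \<Sigma>: "\<Sigma> \<subseteq> \<Omega>" "\<Sigma> \<in> lmeasurable" "measure lebesgue \<Sigma> = t" by auto
  have "integrable lebesgue (indicat_real \<Sigma>)"
    using \<Sigma>(2) by (intro integrable_real_indicator) (auto simp: fmeasurable_def)
  moreover have "(LINT x|lebesgue. indicat_real \<Sigma> x) = t"
    using \<Sigma> by simp
  moreover have "AE x in lebesgue. 0 \<le> indicat_real \<Sigma> x \<and> indicat_real \<Sigma> x \<le> indicat_real \<Omega> x"
    using \<Sigma>(1) by (auto simp: indicator_def)
  ultimately show "TV_profile \<Omega> t \<le> perimeter \<Sigma>"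
    unfolding TV_profile_def perimeter_def by (intro INF_lower) simp
qed

lemma isoperimetric_profile_le_perimeter:
  assumes "compact \<Omega>" "E \<subseteq> \<Omega>" "E \<in> sets borel"
  shows "isoperimetric_profile \<Omega> (measure lborel E) \<le> perimeter E"
proof -
  have "E \<in> lmeasurable"
    using assms bounded_subset[OF compact_imp_bounded] by (intro bounded_set_imp_lmeasurable) auto
  then show ?thesis
    unfolding isoperimetric_profile_def using assms(2,3) by (intro INF_lower) auto
qed

text \<open>Finite values at \<open>0\<close> and at \<open>z\<close> put \<open>t\<close> into the interior of the effective domain, where a real convex
function has a subgradient; outside the effective domain the line lies below \<open>\<infinity>\<close> trivially.\<close>

lemma ereal_convex_on_supporting_line:
  fixes g :: "real \<Rightarrow> ereal"
  assumes g: "ereal_convex_on {0..V} g" and "g 0 < \<infinity>" and z: "z \<in> {0..V}" "g z < \<infinity>" and t: "0 < t" "t < z"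
  shows "\<exists>a b. g t = ereal (a * t + b) \<and> (\<forall>s\<in>{0..V}. ereal (a * s + b) \<le> g s)"
proof -
  define D where "D = {s \<in> {0..V}. g s < \<infinity>}"
  define G where "G s = real_of_ereal (g s)" for s
  have fin: "g s = ereal (G s)" if "s \<in> D" for s
    using that g by (cases "g s") (auto simp: D_def G_def ereal_convex_on_def)
  have comb: "g (u * x + v * y) \<le> ereal (u * G x + v * G y)" "u * x + v * y \<in> D"
    if "x \<in> D" "y \<in> D" "0 \<le> u" "0 \<le> v" "u + v = 1" for x y u v
  proof -
    have xy: "x \<in> {0..V}" "y \<in> {0..V}" using that(1,2) by (auto simp: D_def)
    have "g (u * x + v * y) \<le> ereal u * g x + ereal v * g y"
      using g xy that(3-5) unfolding ereal_convex_on_def by blast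
    then show 1: "g (u * x + v * y) \<le> ereal (u * G x + v * G y)"
      using fin that(1,2) by simp
    have "u *\<^sub>R x + v *\<^sub>R y \<in> {0..V}"
      by (rule convexD) (use xy that in auto)
    then show "u * x + v * y \<in> D" using 1 unfolding D_def by (auto intro: le_less_trans)
  qed
  have "convex D" unfolding convex_def using comb(2) by simp
  have "convex_on D G"
  proof (rule convex_onI)
    fix u x y :: real assume u: "0 < u" "u < 1" and xy: "x \<in> D" "y \<in> D"
    have "g ((1 - u) * x + u * y) \<le> ereal ((1 - u) * G x + u * G y)"
      "(1 - u) * x + u * y \<in> D"
      using comb[OF xy, of "1 - u" u] u by auto
    then show "G ((1 - u) *\<^sub>R x + u *\<^sub>R y) \<le> (1 - u) * G x + u * G y"
      using fin by simp
  qed (rule \<open>convex D\<close>)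
  have "0 \<in> D" "z \<in> D" using assms by (auto simp: D_def)
  then have "{0..z} \<subseteq> D"
    using \<open>convex D\<close> by (metis closed_segment_eq_real_ivl1 convex_contains_segment atLeastatMost_empty_iff empty_subsetI)
  then have "{0<..<z} \<subseteq> interior D"
    by (intro interior_maximal) auto
  then have tint: "t \<in> interior D" using t by auto
  define a where "a = Inf ((\<lambda>s. (G t - G s) / (t - s)) ` ({t<..} \<inter> D))"
  have supp: "G t + a * (s - t) \<le> G s" if "s \<in> D" for s
    unfolding a_def by (rule convex_le_Inf_differential[OF \<open>convex_on D G\<close> tint that])
  show ?thesis
  proof (intro exI conjI ballI)
    show "g t = ereal (a * t + (G t - a * t))"
      using fin[of t] tint interior_subset[of D] by auto
    fix s assume s: "s \<in> {0..V}"
    show "ereal (a * s + (G t - a * t)) \<le> g s"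
    proof (cases "s \<in> D")
      case True
      then show ?thesis using supp[OF True] fin[OF True] by (simp add: algebra_simps)
    next
      case False
      then show ?thesis using s by (simp add: D_def)
    qed
  qed
qed

lemma measure_lborel_subset_compact:
  fixes \<Omega> :: "'a::euclidean_space set"
  assumes "compact \<Omega>" "E \<subseteq> \<Omega>" "E \<in> sets borel"
  shows "measure lborel E \<in> {0..measure lebesgue \<Omega>}"
proof -
  have "measure lborel E \<le> measure lborel \<Omega>"
    using assms emeasure_compact_finite[OF assms(1)]
    by (intro measure_mono_fmeasurable) (auto simp: fmeasurable_def borel_compact)
  moreover have "measure lebesgue \<Omega> = measure lborel \<Omega>"
    using assms(1) by (intro measure_completion) (simp add: borel_compact)
  ultimately show ?thesis by simp
qed

text \<open>At full volume the only competitor is the indicator of \<open>\<Omega>\<close>, up to null sets.\<close>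

lemma total_variation_full_layer:
  fixes f :: "real^'n \<Rightarrow> real"
  assumes \<Omega>: "compact \<Omega>" and f: "layer \<Omega> f" "(LINT x|lborel. f x) = measure lebesgue \<Omega>"
  shows "total_variation f = perimeter \<Omega>"
proof -
  have \<Omega>m: "\<Omega> \<in> sets borel" using \<Omega> by (rule borel_compact)
  have int: "integrable lborel (indicat_real \<Omega>)" using integrable_indicator_compact[OF \<Omega>, of 1] by simp
  have intf: "integrable lborel f" by (rule integrable_layer[OF \<Omega> f(1)])
  have "measure lebesgue \<Omega> = measure lborel \<Omega>"
    using \<Omega>m by (intro measure_completion) simp
  then have "(LINT x|lborel. indicat_real \<Omega> x - f x) = 0"
    using int intf f(2) by simp
  then have "AE x in lborel. indicat_real \<Omega> x - f x = 0"
    using int intf layer_bounds(3)[OF f(1)]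
    by (subst (asm) integral_nonneg_eq_0_iff_AE) auto
  then have "AE x in lborel. f x = indicat_real \<Omega> x" by eventually_elim simp
  then have "AE x in lebesgue. f x = indicat_real \<Omega> x" by (rule AE_completion)
  then show ?thesis
    unfolding perimeter_def using layer_measurable[OF f(1)] \<Omega>m
    by (intro total_variation_cong_AE measurable_completion) auto
qed

theorem proposition3p5:
  fixes \<Omega> :: "(real^'n) set"
  assumes "compact \<Omega>"
    and "\<And>t. t \<in> {0..<measure lebesgue \<Omega>} \<Longrightarrow> TV_profile \<Omega> t < \<infinity>"
  shows "is_lower_convex_envelope_on {0..measure lebesgue \<Omega>}
           (TV_profile \<Omega>) (isoperimetric_profile \<Omega>)"
  unfolding is_lower_convex_envelope_on_def
proof (intro conjI ballI allI impI)
  note \<Omega> = assms(1)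
  define V where "V = measure lebesgue \<Omega>"
  show "ereal_convex_on {0..measure lebesgue \<Omega>} (TV_profile \<Omega>)"
    by (rule TV_profile_convex[OF \<Omega>])
  show "TV_profile \<Omega> t \<le> isoperimetric_profile \<Omega> t" for t
    by (rule TV_profile_le_isoperimetric_profile)
  fix g t
  assume "ereal_convex_on {0..measure lebesgue \<Omega>} g \<and> (\<forall>t\<in>{0..measure lebesgue \<Omega>}. g t \<le> isoperimetric_profile \<Omega> t)"
    and "t \<in> {0..measure lebesgue \<Omega>}"
  then have g: "ereal_convex_on {0..V} g" "\<And>t. t \<in> {0..V} \<Longrightarrow> g t \<le> isoperimetric_profile \<Omega> t"
    and t: "t \<in> {0..V}" by (auto simp: V_def)
  have g_per: "g (measure lborel E) \<le> perimeter E" if "E \<subseteq> \<Omega>" "E \<in> sets borel" for E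
    using g(2)[of "measure lborel E"] isoperimetric_profile_le_perimeter[OF \<Omega> that]
      measure_lborel_subset_compact[OF \<Omega> that] order_trans by (auto simp: V_def)
  have g0: "g 0 \<le> 0"
  proof -
    have "indicat_real ({} :: (real^'n) set) = (\<lambda>_. 0)" by auto
    then show ?thesis using g_per[of "{}"] by (simp add: perimeter_def total_variation_zero)
  qed
  consider "t = 0" | "t = V" | "0 < t" "t < V" using t by force
  then show "g t \<le> TV_profile \<Omega> t"
  proof cases
    case 1
    then show ?thesis using g0 TV_profile_nonneg[of \<Omega> t] by (auto intro: order_trans)
  next
    case 2
    have "g V \<le> total_variation f" if "layer \<Omega> f" "(LINT x|lborel. f x) = V" for f
    proof -
      have "measure lborel \<Omega> = V"
        using \<Omega> by (simp add: V_def borel_compact)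
      then show ?thesis
        using total_variation_full_layer[OF \<Omega> that(1)] that(2) g_per[of \<Omega>] \<Omega>
        by (simp add: V_def borel_compact)
    qed
    then show ?thesis
      unfolding 2 TV_profile_eq_layers[OF \<Omega>] by (intro INF_greatest) auto
  next
    case 3
    have "\<exists>z\<in>{0..V}. t < z \<and> g z < \<infinity>"
    proof (rule ccontr)
      assume "\<not> (\<exists>z\<in>{0..V}. t < z \<and> g z < \<infinity>)"
      then have infinite: "g z = \<infinity>" if "z \<in> {0..V}" "t < z" for z
        using that by auto
      \<comment> \<open>At \<open>y\<close> some competitor \<open>f\<close> has finite total variation. If every set of volume greater than \<open>t\<close> had
      infinite perimeter, \<open>perimeter E \<ge> a (vol E - t)\<close> would hold for all \<open>a > 0\<close>, and \<open>f\<close> would violate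
      the resulting lower bounds \<open>a (y - t)\<close>.\<close>
      define y where "y = (t + V) / 2"
      have y: "t < y" "y \<in> {0..<V}" using 3 by (auto simp: y_def)
      then have "TV_profile \<Omega> y < \<infinity>" using assms(2) by (simp add: V_def)
      then obtain f where f: "layer \<Omega> f" "(LINT x|lborel. f x) = y" "total_variation f < \<infinity>"
        unfolding TV_profile_eq_layers[OF \<Omega>] INF_less_iff by auto
      have *: "ereal (a * (y - t)) \<le> total_variation f" if "a > 0" for a
      proof -
        have per: "ereal (a * measure lborel E + - a * t) \<le> perimeter E"
          if E: "E \<subseteq> \<Omega>" "E \<in> sets borel" for E
        proof (cases "t < measure lborel E")
          case True
          then have "perimeter E = \<infinity>"
            using infinite g_per[OF E] measure_lborel_subset_compact[OF \<Omega> E] by (simp add: V_def)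
          then show ?thesis by simp
        next
          case False
          then have "a * measure lborel E + - a * t \<le> 0"
            using \<open>a > 0\<close> by simp
          then have "ereal (a * measure lborel E + - a * t) \<le> 0" by simp
          also have "0 \<le> perimeter E"
            unfolding perimeter_def by (rule total_variation_nonneg)
          finally show ?thesis .
        qed
        have "ereal (a * (LINT x|lborel. f x) + - a * t) \<le> total_variation f"
          by (rule total_variation_ge_affine[OF \<Omega> f(1) per])
        moreover have "a * (LINT x|lborel. f x) + - a * t = a * (y - t)"
          unfolding f(2) by (simp add: right_diff_distrib)
        ultimately show ?thesis by (simp only:)
      qed
      obtain T where T: "total_variation f = ereal T" "0 \<le> T"
        using f(3) total_variation_nonneg[of f] by (cases "total_variation f") auto
      have "(T + 1) / (y - t) * (y - t) = T + 1" using y by simp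
      then show False using *[of "(T + 1) / (y - t)"] y T by simp
    qed
    then obtain z where z: "z \<in> {0..V}" "g z < \<infinity>" "t < z" by blast
    have "g 0 < \<infinity>" using g0 by (auto intro: le_less_trans)
    have "\<exists>a b. g t = ereal (a * t + b) \<and> (\<forall>s\<in>{0..V}. ereal (a * s + b) \<le> g s)"
      by (rule ereal_convex_on_supporting_line[OF g(1) \<open>g 0 < \<infinity>\<close> z(1,2) 3(1) z(3)])
    then obtain a b where "g t = ereal (a * t + b) \<and> (\<forall>s\<in>{0..V}. ereal (a * s + b) \<le> g s)"
      by (elim exE)
    note ab = conjunct1[OF this] conjunct2[OF this]
    have per: "ereal (a * measure lborel E + b) \<le> perimeter E" if E: "E \<subseteq> \<Omega>" "E \<in> sets borel" for E
    proof -
      have "measure lborel E \<in> {0..V}"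
        unfolding V_def by (rule measure_lborel_subset_compact[OF \<Omega> E])
      with ab(2) have "ereal (a * measure lborel E + b) \<le> g (measure lborel E)" by (rule bspec)
      also have "\<dots> \<le> perimeter E" by (rule g_per[OF E])
      finally show ?thesis .
    qed
    have "ereal (a * t + b) \<le> total_variation f" if "layer \<Omega> f" "(LINT x|lborel. f x) = t" for f
      using total_variation_ge_affine[OF \<Omega> that(1) per] unfolding that(2) .
    then show ?thesis
      unfolding TV_profile_eq_layers[OF \<Omega>] ab(1) by (intro INF_greatest) simp
  qed
qed

end
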